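(* Let $\mathbb{K}$ be a field and let $M\in M_n(\mathbb{K})$ be $\mathbb{K}$-regular. Then there exists a unique complete additive Jordan–Chevalley decomposition over $\mathbb{K}$ of $M$, $M = H(M)+V(M)+N(M)$. Moreover $H(M)$, $V(M)$, $N(M)$ are polynomial expressions of $M$ with coefficients in $\mathbb{K}$, and $H(M)+V(M)$ and $N(M)$ coincide respectively with the semisimple and the nilpotent components of the additive Jordan–Chevalley decomposition of $M$.
   Context: An element of $\overline{\mathbb{K}}$ (fixed algebraic closure) is $\mathbb{K}$-regular if its degree over $\mathbb{K}$ is not a multiple of $char(\mathbb{K})$; $\mathcal{R}_\mathbb{K}$ is the set of such elements. For $\lambda\in\mathcal{R}_\mathbb{K}$ with monic minimal polynomial $X^d+a_{d-1}X^{d-1}+\cdots+a_0$, $H_\mathbb{K}(\lambda)=-a_{d-1}/d$ and $Ker(H_\mathbb{K})=\{\lambda\in\mathcal{R}_\mathbb{K}:H_\mathbb{K}(\lambda)=0\}$. A matrix in $M_n(\mathbb{K})$ is $\mathbb{K}$-regular if all its eigenvalues lie in $\mathcal{R}_\mathbb{K}$; a $\mathbb{K}$-regular matrix is $\mathbb{K}$-vertical if all its eigenvalues lie in $Ker(H_\mathbb{K})$. A complete additive Jordan–Chevalley decomposition over $\mathbb{K}$ of $M\in M_n(\mathbb{K})$ is a decomposition $M=H+V+N$ with $H,V,N\in M_n(\mathbb{K})$ mutually commuting, $H$ diagonalizable over $\mathbb{K}$, $V$ $\mathbb{K}$-vertical and semisimple (diagonalizable over $\overline{\mathbb{K}}$),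 and $N$ nilpotent. The additive Jordan–Chevalley decomposition is the unique decomposition $M=S+N$ with $S$ semisimple, $N$ nilpotent, $SN=NS$. *)

theory Defs
  imports "HOL-Algebra.Algebraic_Closure_Type" "Jordan_Normal_Form.Jordan_Normal_Form"
begin

definition min_poly_K :: "'a::field alg_closure \<Rightarrow> 'a poly" where
  "min_poly_K x = (THE p. monic p \<and> poly (map_poly to_ac p) x = 0 \<and>
      (\<forall>q. poly (map_poly to_ac q) x = 0 \<longrightarrow> p dvd q))"

definition deg_K :: "'a::field alg_closure \<Rightarrow> nat" where
  "deg_K x = degree (min_poly_K x)"

definition K_regular_elem :: "'a::field alg_closure \<Rightarrow> bool" where
  "K_regular_elem x \<longleftrightarrow> \<not> (CHAR('a) dvd deg_K x)"

definition H_K :: "'a::field alg_closure \<Rightarrow> 'a" where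
  "H_K x = - coeff (min_poly_K x) (deg_K x - 1) / of_nat (deg_K x)"

definition Ker_H_K :: "'a::field alg_closure set" where
  "Ker_H_K = {x. K_regular_elem x \<and> H_K x = 0}"

definition K_regular_mat :: "'a::field mat \<Rightarrow> bool" where
  "K_regular_mat M \<longleftrightarrow> (\<forall>x. eigenvalue (map_mat to_ac M) x \<longrightarrow> K_regular_elem x)"

definition K_vertical_mat :: "'a::field mat \<Rightarrow> bool" where
  "K_vertical_mat M \<longleftrightarrow> K_regular_mat M \<and>
     (\<forall>x. eigenvalue (map_mat to_ac M) x \<longrightarrow> x \<in> Ker_H_K)"

definition diagonalizable_mat :: "'b::field mat \<Rightarrow> bool" where
  "diagonalizable_mat A \<longleftrightarrow> (\<exists>D. similar_mat A D \<and> diagonal_mat D)"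

definition semisimple_mat :: "'a::field mat \<Rightarrow> bool" where
  "semisimple_mat A \<longleftrightarrow> diagonalizable_mat (map_mat to_ac A)"

definition nilpotent_mat :: "'b::field mat \<Rightarrow> bool" where
  "nilpotent_mat A \<longleftrightarrow> (\<exists>k. A ^\<^sub>m k = 0\<^sub>m (dim_row A) (dim_col A))"

text \<open>Evaluation of a polynomial with coefficients in 'a at a square matrix (Horner scheme).\<close>
definition poly_mat :: "'b::field poly \<Rightarrow> 'b mat \<Rightarrow> 'b mat" where
  "poly_mat p A = foldr (\<lambda>c B. c \<cdot>\<^sub>m 1\<^sub>m (dim_row A) + A * B) (coeffs p)
      (0\<^sub>m (dim_row A) (dim_row A))"

definition complete_JCD :: "nat \<Rightarrow> 'a::field mat \<Rightarrow> 'a mat \<Rightarrow> 'a mat \<Rightarrow> 'a mat \<Rightarrow> bool" where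
  "complete_JCD n M H V N \<longleftrightarrow>
     H \<in> carrier_mat n n \<and> V \<in> carrier_mat n n \<and> N \<in> carrier_mat n n \<and>
     M = H + V + N \<and>
     H * V = V * H \<and> H * N = N * H \<and> V * N = N * V \<and>
     diagonalizable_mat H \<and> K_vertical_mat V \<and> semisimple_mat V \<and> nilpotent_mat N"

definition additive_JCD :: "nat \<Rightarrow> 'a::field mat \<Rightarrow> 'a mat \<Rightarrow> 'a mat \<Rightarrow> bool" where
  "additive_JCD n M S N \<longleftrightarrow>
     S \<in> carrier_mat n n \<and> N \<in> carrier_mat n n \<and> M = S + N \<and> S * N = N * S \<and>
     semisimple_mat S \<and> nilpotent_mat N"

end

theory Submission
  imports Defs "Jordan_Normal_Form.DL_Rank"
begin

text \<open>
  Let \<open>\<chi>\<close> be the characteristic polynomial of \<open>M\<close> and \<open>\<mu>\<close> the product of the distinct minimal polynomials of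
  the eigenvalues of \<open>M\<close>. The derivative of a minimal polynomial of degree \<open>d\<close> has leading term \<open>d X\<^bsup>d-1\<^esup>\<close>, so
  regularity makes \<open>\<mu>\<close> separable. Newton iteration then gives a polynomial \<open>s\<close> with \<open>s \<equiv> X\<close> modulo \<open>\<mu>\<close> and
  \<open>\<mu>(s) \<equiv> 0\<close> modulo \<open>\<chi>\<close>, so \<open>S = s(M)\<close> is semisimple and \<open>N = M - S\<close> is nilpotent. The Chinese remainder
  theorem gives \<open>h\<close> over \<open>K\<close> taking the value \<open>H\<^sub>K(x)\<close> at each root \<open>x\<close> of \<open>\<mu>\<close>; put \<open>H = h(S)\<close> and
  \<open>V = S - H\<close>. Since \<open>H\<^sub>K(x + a) = H\<^sub>K(x) + a\<close> for \<open>a\<close> in \<open>K\<close>, the eigenvalues \<open>x - H\<^sub>K(x)\<close> of \<open>V\<close> lie in the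
  kernel of \<open>H\<^sub>K\<close>.

  Uniqueness is checked on vectors: a matrix vanishes once it kills all joint eigenvectors, over the algebraic
  closure, of two commuting semisimple matrices. On a joint eigenvector of \<open>H'\<close> and \<open>V'\<close> with eigenvalues
  \<open>a\<close> and \<open>b\<close>, the matrix \<open>H = h(H' + V')\<close> acts as \<open>H\<^sub>K(a + b) = a\<close>.
\<close>

section \<open>Polynomials in a matrix\<close>

lemma poly_mat_carrier [intro]:
  assumes "A \<in> carrier_mat n n"
  shows "poly_mat p A \<in> carrier_mat n n"
proof -
  have "foldr (\<lambda>c B. c \<cdot>\<^sub>m 1\<^sub>m (dim_row A) + A * B) cs (0\<^sub>m (dim_row A) (dim_row A)) \<in> carrier_mat n n" for cs
    using assms by (induction cs) auto
  then show ?thesis by (simp add: poly_mat_def)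
qed

lemma poly_mat_dim [simp]:
  "dim_row (poly_mat p A) = dim_row A" "dim_col (poly_mat p A) = dim_row A"
proof -
  have "dim_row (foldr (\<lambda>c B. c \<cdot>\<^sub>m 1\<^sub>m (dim_row A) + A * B) cs (0\<^sub>m (dim_row A) (dim_row A))) = dim_row A \<and>
    dim_col (foldr (\<lambda>c B. c \<cdot>\<^sub>m 1\<^sub>m (dim_row A) + A * B) cs (0\<^sub>m (dim_row A) (dim_row A))) = dim_row A" for cs
    by (induction cs) auto
  then show "dim_row (poly_mat p A) = dim_row A" "dim_col (poly_mat p A) = dim_row A"
    by (simp_all add: poly_mat_def)
qed

lemma smult_smult_mat: "c \<cdot>\<^sub>m (d \<cdot>\<^sub>m A) = (c * d) \<cdot>\<^sub>m (A :: 'a :: semiring_1 mat)"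
  by (intro eq_matI) (auto simp: mult.assoc)

lemma zero_smult_mat: "0 \<cdot>\<^sub>m A = 0\<^sub>m (dim_row A) (dim_col A)" for A :: "'a :: semiring_0 mat"
  by (intro eq_matI) auto

lemma smult_one_mat_mult_vec: "v \<in> carrier_vec n \<Longrightarrow> c \<cdot>\<^sub>m 1\<^sub>m n *\<^sub>v v = c \<cdot>\<^sub>v v"
  for c :: "'a :: field"
  by (intro eq_vecI) (auto simp: smult_scalar_prod_distrib[of _ n])

lemma poly_mat_0 [simp]: "A \<in> carrier_mat n n \<Longrightarrow> poly_mat 0 A = 0\<^sub>m n n"
  by (simp add: poly_mat_def)

text \<open>One step of the Horner fold. The case \<open>pCons 0 0\<close> is separate because its
  coefficient list is empty, so the fold does not unfold; there both sides vanish.\<close>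

lemma poly_mat_pCons:
  assumes "A \<in> carrier_mat n n"
  shows "poly_mat (pCons c p) A = c \<cdot>\<^sub>m 1\<^sub>m n + A * poly_mat p A"
proof (cases "c = 0 \<and> p = 0")
  case True
  have "0 \<cdot>\<^sub>m 1\<^sub>m n + A * 0\<^sub>m n n = 0\<^sub>m n n"
    using assms by (intro eq_matI) auto
  then show ?thesis using True assms by simp
next
  case False
  then show ?thesis using assms by (auto simp: poly_mat_def cCons_def)
qed

lemma poly_mat_const: "A \<in> carrier_mat n n \<Longrightarrow> poly_mat [:c:] A = c \<cdot>\<^sub>m 1\<^sub>m n"
  by (simp add: poly_mat_pCons)

lemma poly_mat_1 [simp]: "A \<in> carrier_mat n n \<Longrightarrow> poly_mat 1 A = 1\<^sub>m n"
  by (simp add: one_pCons poly_mat_const) (intro eq_matI, auto)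

lemma poly_mat_X: "A \<in> carrier_mat n n \<Longrightarrow> poly_mat [:0, 1:] A = A"
  by (simp add: poly_mat_pCons) (intro eq_matI, auto)

lemma poly_mat_add:
  assumes A: "A \<in> carrier_mat n n"
  shows "poly_mat (p + q) A = poly_mat p A + poly_mat q A"
proof (induction p q rule: poly_induct2)
  case 0
  then show ?case using A by simp
next
  case (pCons a p b q)
  have "poly_mat (pCons a p + pCons b q) A = (a + b) \<cdot>\<^sub>m 1\<^sub>m n + A * (poly_mat p A + poly_mat q A)"
    using A pCons by (simp add: poly_mat_pCons)
  also have "\<dots> = (a \<cdot>\<^sub>m 1\<^sub>m n + b \<cdot>\<^sub>m 1\<^sub>m n) + (A * poly_mat p A + A * poly_mat q A)"
    using A poly_mat_carrier[OF A]
    by (simp add: add_smult_distrib_right_mat[of _ n n] mult_add_distrib_mat[of _ n n _ n])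
  also have "\<dots> = (a \<cdot>\<^sub>m 1\<^sub>m n + A * poly_mat p A) + (b \<cdot>\<^sub>m 1\<^sub>m n + A * poly_mat q A)"
    using A poly_mat_carrier[OF A, of p] poly_mat_carrier[OF A, of q]
    by (intro eq_matI) (auto simp: algebra_simps)
  finally show ?case using A by (simp add: poly_mat_pCons)
qed

lemma poly_mat_smult:
  assumes A: "A \<in> carrier_mat n n"
  shows "poly_mat (smult c p) A = c \<cdot>\<^sub>m poly_mat p A"
proof (induction p)
  case 0
  then show ?case using A by simp
next
  case (pCons a p)
  have "poly_mat (smult c (pCons a p)) A = (c * a) \<cdot>\<^sub>m 1\<^sub>m n + A * (c \<cdot>\<^sub>m poly_mat p A)"
    using A pCons by (simp add: poly_mat_pCons)
  also have "\<dots> = c \<cdot>\<^sub>m (a \<cdot>\<^sub>m 1\<^sub>m n) + c \<cdot>\<^sub>m (A * poly_mat p A)"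
    using mult_smult_distrib[OF A poly_mat_carrier[OF A, of p], of c] A
    by (simp add: smult_smult_mat)
  also have "\<dots> = c \<cdot>\<^sub>m (a \<cdot>\<^sub>m 1\<^sub>m n + A * poly_mat p A)"
    using A by (intro add_smult_distrib_left_mat[symmetric, of _ n n]) auto
  finally show ?case using A by (simp add: poly_mat_pCons)
qed

lemma poly_mat_diff:
  assumes A: "A \<in> carrier_mat n n"
  shows "poly_mat (p - q) A = poly_mat p A - poly_mat q A"
proof -
  have "poly_mat (p - q) A = poly_mat p A + (-1) \<cdot>\<^sub>m poly_mat q A"
    using poly_mat_add[OF A, of p "smult (-1) q"] poly_mat_smult[OF A, of "-1" q] by simp
  also have "\<dots> = poly_mat p A - poly_mat q A"
    using poly_mat_carrier[OF A, of p] poly_mat_carrier[OF A, of q]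
    by (intro eq_matI) auto
  finally show ?thesis .
qed

lemma poly_mat_mult:
  assumes A: "A \<in> carrier_mat n n"
  shows "poly_mat (p * q) A = poly_mat p A * poly_mat q A"
proof (induction p)
  case 0
  then show ?case using A poly_mat_carrier[OF A, of q] by simp
next
  case (pCons a p)
  note P = poly_mat_carrier[OF A, of p] and Q = poly_mat_carrier[OF A, of q]
  have "poly_mat (pCons a p * q) A = a \<cdot>\<^sub>m poly_mat q A + (0 \<cdot>\<^sub>m 1\<^sub>m n + A * (poly_mat p A * poly_mat q A))"
    using A pCons by (simp add: poly_mat_pCons poly_mat_add poly_mat_smult)
  also have "0 \<cdot>\<^sub>m 1\<^sub>m n + A * (poly_mat p A * poly_mat q A) = A * poly_mat p A * poly_mat q A"
    using A P Q by (subst assoc_mult_mat[of _ n n _ n _ n]) (simp_all add: zero_smult_mat)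
  also have "a \<cdot>\<^sub>m poly_mat q A = a \<cdot>\<^sub>m 1\<^sub>m n * poly_mat q A"
    using mult_smult_assoc_mat[of "1\<^sub>m n" n n "poly_mat q A" n a] left_mult_one_mat[OF Q] Q by simp
  also have "a \<cdot>\<^sub>m 1\<^sub>m n * poly_mat q A + A * poly_mat p A * poly_mat q A
      = (a \<cdot>\<^sub>m 1\<^sub>m n + A * poly_mat p A) * poly_mat q A"
    using A P Q by (intro add_mult_distrib_mat[symmetric, of _ n n _ _ n]) auto
  finally show ?case using A by (simp add: poly_mat_pCons)
qed

lemma poly_mat_commute:
  assumes "A \<in> carrier_mat n n"
  shows "poly_mat p A * poly_mat q A = poly_mat q A * poly_mat p A"
  using poly_mat_mult[OF assms, of p q] poly_mat_mult[OF assms, of q p] by (simp add: mult.commute)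

lemma poly_mat_commuteI:
  assumes A: "A \<in> carrier_mat n n" and B: "B \<in> carrier_mat n n" and AB: "A * B = B * A"
  shows "poly_mat p A * B = B * poly_mat p A"
proof (induction p)
  case 0
  then show ?case using A B by simp
next
  case (pCons a p)
  note P = poly_mat_carrier[OF A, of p]
  have "poly_mat (pCons a p) A * B = a \<cdot>\<^sub>m 1\<^sub>m n * B + A * poly_mat p A * B"
    unfolding poly_mat_pCons[OF A] using A P B by (intro add_mult_distrib_mat[of _ n n _ _ n]) auto
  also have "a \<cdot>\<^sub>m 1\<^sub>m n * B = B * (a \<cdot>\<^sub>m 1\<^sub>m n)"
    using mult_smult_assoc_mat[of "1\<^sub>m n" n n B n a] mult_smult_distrib[of B n n "1\<^sub>m n" n a] B by simp
  also have "A * poly_mat p A * B = A * (B * poly_mat p A)"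
    using A P B pCons by (simp add: assoc_mult_mat[of _ n n _ n _ n])
  also have "\<dots> = B * (A * poly_mat p A)"
    using assoc_mult_mat[OF A B P] assoc_mult_mat[OF B A P] AB by simp
  also have "B * (a \<cdot>\<^sub>m 1\<^sub>m n) + B * (A * poly_mat p A) = B * poly_mat (pCons a p) A"
    unfolding poly_mat_pCons[OF A] using A P B by (intro mult_add_distrib_mat[symmetric, of _ n n _ n]) auto
  finally show ?case .
qed

lemma poly_mat_pow:
  assumes A: "A \<in> carrier_mat n n"
  shows "poly_mat (p ^ k) A = poly_mat p A ^\<^sub>m k"
proof (induction k)
  case 0
  then show ?case using A by auto
next
  case (Suc k)
  have "poly_mat (p ^ Suc k) A = poly_mat (p ^ k * p) A" by (simp add: mult.commute)
  then show ?case using Suc A by (simp add: poly_mat_mult)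
qed

lemma poly_mat_pcompose:
  assumes A: "A \<in> carrier_mat n n"
  shows "poly_mat (pcompose p q) A = poly_mat p (poly_mat q A)"
proof (induction p)
  case 0
  then show ?case using poly_mat_carrier[OF A, of q] A by simp
next
  case (pCons a p)
  then show ?case using A poly_mat_carrier[OF A, of q]
    by (simp add: poly_mat_pCons[of _ n] poly_mat_add poly_mat_mult poly_mat_const)
qed

lemma poly_mat_zero_dvd:
  assumes A: "A \<in> carrier_mat n n" and "poly_mat p A = 0\<^sub>m n n" and "p dvd q"
  shows "poly_mat q A = 0\<^sub>m n n"
proof -
  obtain r where "q = p * r" using assms(3) by blast
  then show ?thesis using assms by (simp add: poly_mat_mult[OF A] left_mult_zero_mat[OF poly_mat_carrier[OF A]])
qed

lemma poly_mat_similar: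
  assumes "similar_mat_wit A B P Q"
  shows "similar_mat_wit (poly_mat p A) (poly_mat p B) P Q"
proof -
  define n where "n = dim_row A"
  note w = similar_mat_witD[OF n_def assms]
  note A = w(4) and B = w(5) and P = w(6) and Q = w(7)
  have "poly_mat p A = P * poly_mat p B * Q"
  proof (induction p)
    case 0
    then show ?case using A B P Q by simp
  next
    case (pCons a p)
    note pB = poly_mat_carrier[OF B, of p]
    have "P * poly_mat (pCons a p) B * Q = (P * (a \<cdot>\<^sub>m 1\<^sub>m n) + P * (B * poly_mat p B)) * Q"
      unfolding poly_mat_pCons[OF B] using P B pB
      by (subst mult_add_distrib_mat[of _ n n _ n]) auto
    also have "\<dots> = P * (a \<cdot>\<^sub>m 1\<^sub>m n) * Q + P * (B * poly_mat p B) * Q"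
      using P Q B pB by (intro add_mult_distrib_mat[of _ n n _ _ n]) auto
    also have "P * (a \<cdot>\<^sub>m 1\<^sub>m n) * Q = a \<cdot>\<^sub>m 1\<^sub>m n"
      using mult_smult_distrib[of P n n "1\<^sub>m n" n a] mult_smult_assoc_mat[of P n n Q n a] P Q w(1) by simp
    \<comment> \<open>Inserting \<open>Q * P\<close>, the identity, splits the conjugate of a
      product into the product of the two conjugates.\<close>
    also have "P * (B * poly_mat p B) * Q = P * B * ((Q * P) * poly_mat p B) * Q"
      unfolding w(2) left_mult_one_mat[OF pB] using P Q B pB by (simp add: assoc_mult_mat[of _ n n _ n _ n])
    also have "\<dots> = (P * B * Q) * (P * poly_mat p B * Q)"
      using P Q B pB by (simp add: assoc_mult_mat[of _ n n _ n _ n])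
    also have "\<dots> = A * poly_mat p A" using pCons w(3) by simp
    finally show ?case using A by (simp add: poly_mat_pCons)
  qed
  then show ?thesis using w A B by (intro similar_mat_witI[of _ _ n]) auto
qed

lemma poly_mat_eigenvector:
  assumes A: "A \<in> carrier_mat n n" and v: "v \<in> carrier_vec n" and ev: "A *\<^sub>v v = a \<cdot>\<^sub>v v"
  shows "poly_mat p A *\<^sub>v v = poly p a \<cdot>\<^sub>v v"
proof (induction p)
  case 0
  then show ?case using A v by auto
next
  case (pCons c p)
  note P = poly_mat_carrier[OF A, of p]
  have "poly_mat (pCons c p) A *\<^sub>v v = c \<cdot>\<^sub>m 1\<^sub>m n *\<^sub>v v + A *\<^sub>v (poly_mat p A *\<^sub>v v)"
    unfolding poly_mat_pCons[OF A] using A P v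
    by (subst add_mult_distrib_mat_vec[of _ n n]) (auto simp: assoc_mult_mat_vec[of _ n n _ n])
  also have "\<dots> = c \<cdot>\<^sub>v v + A *\<^sub>v (poly p a \<cdot>\<^sub>v v)"
    using pCons v by (simp add: smult_one_mat_mult_vec)
  also have "A *\<^sub>v (poly p a \<cdot>\<^sub>v v) = poly p a \<cdot>\<^sub>v (a \<cdot>\<^sub>v v)"
    using A v ev by (simp add: mult_mat_vec)
  also have "c \<cdot>\<^sub>v v + \<dots> = poly (pCons c p) a \<cdot>\<^sub>v v"
    using v by (intro eq_vecI) (auto simp: algebra_simps)
  finally show ?case .
qed

lemma poly_mat_mult_vec:
  assumes "A \<in> carrier_mat n n" "v \<in> carrier_vec n"
  shows "poly_mat (p * q) A *\<^sub>v v = poly_mat p A *\<^sub>v (poly_mat q A *\<^sub>v v)"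
  using assms poly_mat_carrier[OF assms(1)] by (simp add: poly_mat_mult assoc_mult_mat_vec[of _ n n _ n])

lemma poly_mat_add_vec:
  assumes "A \<in> carrier_mat n n" "v \<in> carrier_vec n"
  shows "poly_mat (p + q) A *\<^sub>v v = poly_mat p A *\<^sub>v v + poly_mat q A *\<^sub>v v"
  using assms poly_mat_carrier[OF assms(1)] by (simp add: poly_mat_add add_mult_distrib_mat_vec[of _ n n])

lemma poly_mat_linear_vec:
  assumes A: "A \<in> carrier_mat n n" and v: "v \<in> carrier_vec n"
  shows "poly_mat [:- a, 1:] A *\<^sub>v v = 0\<^sub>v n \<longleftrightarrow> A *\<^sub>v v = a \<cdot>\<^sub>v v"
proof -
  have "poly_mat [:- a, 1:] A *\<^sub>v v = A *\<^sub>v v - a \<cdot>\<^sub>v v"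
  proof -
    have "[:- a, 1:] = [:0, 1:] - [:a:]" by simp
    then have "poly_mat [:- a, 1:] A = A - a \<cdot>\<^sub>m 1\<^sub>m n"
      by (simp only: poly_mat_diff[OF A] poly_mat_X[OF A] poly_mat_const[OF A])
    then show ?thesis using A v by (simp add: minus_mult_distrib_mat_vec[of _ n n] smult_one_mat_mult_vec)
  qed
  moreover have "A *\<^sub>v v - a \<cdot>\<^sub>v v = 0\<^sub>v n \<longleftrightarrow> A *\<^sub>v v = a \<cdot>\<^sub>v v"
    using A v by (auto simp: vec_eq_iff)
  ultimately show ?thesis by simp
qed

lemma poly_mat_sum_index:
  assumes A: "A \<in> carrier_mat n n" and "finite I" and "r < n" "s < n"
  shows "poly_mat (sum f I) A $$ (r, s) = (\<Sum>j\<in>I. poly_mat (f j) A $$ (r, s))"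
  using assms(2)
proof (induction I rule: finite_induct)
  case empty
  then show ?case using assms by simp
next
  case (insert j I)
  then show ?case using assms by (simp add: poly_mat_add[OF A])
qed

text \<open>Coordinatewise, \<open>\<chi>(A) e\<^sub>k = \<Sum>\<^sub>i (\<chi> \<delta>\<^sub>i\<^sub>k)(A) e\<^sub>i\<close>. Since \<open>(X I - A) adj(X I - A) = \<chi> I\<close>, this is an
  \<open>F[X]\<close>-linear combination of the vectors \<open>\<Sum>\<^sub>i (X \<delta>\<^sub>i\<^sub>j - A\<^sub>i\<^sub>j)(A) e\<^sub>i = A e\<^sub>j - A e\<^sub>j = 0\<close>.\<close>
theorem cayley_hamilton:
  fixes A :: "'a :: field mat"
  assumes A: "A \<in> carrier_mat n n"
  shows "poly_mat (char_poly A) A = 0\<^sub>m n n"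
proof (rule eq_matI)
  define C where "C = char_poly_matrix A"
  define B where "B = adj_mat C"
  define \<chi> where "\<chi> = char_poly A"
  have C: "C \<in> carrier_mat n n" using A by (simp add: C_def)
  have B: "B \<in> carrier_mat n n" using adj_mat(1)[OF C] by (simp add: B_def)
  have CB: "C * B = \<chi> \<cdot>\<^sub>m 1\<^sub>m n"
    using adj_mat(2)[OF C] by (simp add: B_def \<chi>_def char_poly_def C_def)
  have CB': "(\<Sum>j<n. C $$ (i,j) * B $$ (j,k)) = (if i = k then \<chi> else 0)" if "i < n" "k < n" for i k
  proof -
    have "(C * B) $$ (i,k) = (\<Sum>j<n. C $$ (i,j) * B $$ (j,k))"
      using that B C by (auto simp: scalar_prod_def lessThan_atLeast0)
    then show ?thesis using that by (auto simp: CB)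
  qed
  have Cij: "C $$ (i,j) = (if i = j then [:0,1:] else 0) - [:A $$ (i,j):]" if "i < n" "j < n" for i j
    using that A by (auto simp: C_def char_poly_matrix_def)
  have sum0: "(\<Sum>i<n. poly_mat (C $$ (i,j)) A $$ (s,i)) = 0" if sj: "s < n" "j < n" for s j
  proof -
    have "(\<Sum>i<n. poly_mat (C $$ (i,j)) A $$ (s,i))
        = (\<Sum>i<n. (if i = j then A $$ (s,i) else 0) - (if i = s then A $$ (i,j) else 0))"
      using sj A poly_mat_X[OF A]
      by (intro sum.cong refl) (auto simp: Cij poly_mat_diff[OF A] poly_mat_const[OF A])
    also have "\<dots> = 0" using sj by (simp add: sum_subtractf)
    finally show ?thesis .
  qed
  fix r k assume "r < dim_row (0\<^sub>m n n :: 'a mat)" "k < dim_col (0\<^sub>m n n :: 'a mat)"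
  then have r: "r < n" and k: "k < n" by auto
  have "poly_mat \<chi> A $$ (r,k) = (\<Sum>i<n. if i = k then poly_mat \<chi> A $$ (r,i) else 0)"
    using k by simp
  also have "\<dots> = (\<Sum>i<n. poly_mat (if i = k then \<chi> else 0) A $$ (r,i))"
    using r A by (intro sum.cong) auto
  also have "\<dots> = (\<Sum>i<n. poly_mat (\<Sum>j<n. C $$ (i,j) * B $$ (j,k)) A $$ (r,i))"
    using k by (intro sum.cong) (auto simp: CB')
  also have "\<dots> = (\<Sum>i<n. \<Sum>j<n. poly_mat (B $$ (j,k) * C $$ (i,j)) A $$ (r,i))"
    using r by (intro sum.cong) (auto simp: poly_mat_sum_index[OF A] mult.commute)
  also have "\<dots> = (\<Sum>i<n. \<Sum>j<n. \<Sum>s<n. poly_mat (B $$ (j,k)) A $$ (r,s) * poly_mat (C $$ (i,j)) A $$ (s,i))"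
    using r A by (intro sum.cong) (auto simp: poly_mat_mult[OF A] scalar_prod_def lessThan_atLeast0)
  \<comment> \<open>The two exchanges move the sum over \<open>i\<close> innermost, where
    \<open>poly_mat (B $$ (j,k)) A $$ (r,s)\<close> factors out and leaves exactly the sum in
    \<open>sum0\<close>.\<close>
  also have "\<dots> = (\<Sum>j<n. \<Sum>i<n. \<Sum>s<n. poly_mat (B $$ (j,k)) A $$ (r,s) * poly_mat (C $$ (i,j)) A $$ (s,i))"
    by (rule sum.swap)
  also have "\<dots> = (\<Sum>j<n. \<Sum>s<n. \<Sum>i<n. poly_mat (B $$ (j,k)) A $$ (r,s) * poly_mat (C $$ (i,j)) A $$ (s,i))"
    by (intro sum.cong refl sum.swap)
  also have "\<dots> = 0"
    by (simp add: sum0 flip: sum_distrib_left)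
  finally show "poly_mat (char_poly A) A $$ (r,k) = 0\<^sub>m n n $$ (r,k)"
    using r k by (simp add: \<chi>_def)
qed (use A in auto)

section \<open>Eigenvectors and diagonalizability\<close>

lemma zero_mat_mult_vec: "v \<in> carrier_vec n \<Longrightarrow> 0\<^sub>m m n *\<^sub>v v = (0\<^sub>v m :: 'a :: semiring_0 vec)"
  by (intro eq_vecI) (auto simp: scalar_prod_def)

lemma mat_mult_zero_vec: "A \<in> carrier_mat m n \<Longrightarrow> A *\<^sub>v 0\<^sub>v n = (0\<^sub>v m :: 'a :: semiring_0 vec)"
  by (intro eq_vecI) (auto simp: scalar_prod_def)

lemma mat_eq_zeroI:
  assumes T: "T \<in> carrier_mat n n" and "\<And>v. v \<in> carrier_vec n \<Longrightarrow> T *\<^sub>v v = 0\<^sub>v n"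
  shows "T = (0\<^sub>m n n :: 'a :: semiring_1 mat)"
proof (rule eq_matI)
  fix i j assume "i < dim_row (0\<^sub>m n n :: 'a mat)" "j < dim_col (0\<^sub>m n n :: 'a mat)"
  then have ij: "i < n" "j < n" by auto
  have "T $$ (i,j) = (T *\<^sub>v unit_vec n j) $ i"
    using ij T by (simp add: scalar_prod_right_unit)
  then show "T $$ (i,j) = 0\<^sub>m n n $$ (i,j)"
    using assms(2)[of "unit_vec n j"] ij by simp
qed (use T in auto)

text \<open>With \<open>q = \<Prod>\<^bsub>e' \<noteq> e\<^esub> (X - e')\<close> and \<open>q = (X - e) t + q(e)\<close>, the vector \<open>q(e) v\<close> is the difference of the
  eigenvector \<open>q(A) v\<close> and of \<open>t(A) (A - e) v\<close>, which is annihilated by \<open>q(A)\<close>.\<close>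
lemma vec_in_sum_of_eigenspaces:
  fixes A :: "'a :: field mat"
  assumes A: "A \<in> carrier_mat n n" and U: "U \<subseteq> carrier_vec n"
    and inv: "\<And>v p. v \<in> U \<Longrightarrow> poly_mat p A *\<^sub>v v \<in> U"
    and zero: "0\<^sub>v n \<in> W" and add: "\<And>v w. v \<in> W \<Longrightarrow> w \<in> W \<Longrightarrow> v + w \<in> W"
    and smult: "\<And>c v. v \<in> W \<Longrightarrow> c \<cdot>\<^sub>v v \<in> W"
    and eig: "\<And>e v. v \<in> U \<Longrightarrow> A *\<^sub>v v = e \<cdot>\<^sub>v v \<Longrightarrow> v \<in> W"
    and "finite E" and "v \<in> U" and "poly_mat (\<Prod>e\<in>E. [:- e, 1:]) A *\<^sub>v v = 0\<^sub>v n"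
  shows "v \<in> W"
  using assms(8-)
\<comment> \<open>The vector is generalized because the induction hypothesis is applied to
  \<open>v2\<close>, whose annihilator has lost the factor of \<open>e\<close>.\<close>
proof (induction E arbitrary: v rule: finite_induct)
  case empty
  then have "v = 0\<^sub>v n" using U A by (auto simp: poly_mat_1[OF A])
  then show ?case using zero by simp
next
  case (insert e E)
  define q where "q = (\<Prod>e\<in>E. [:- e, 1:])"
  define c where "c = poly q e"
  have v: "v \<in> carrier_vec n" using insert.prems U by auto
  have c: "c \<noteq> 0" using insert.hyps by (auto simp: c_def q_def poly_prod)
  have "poly (q - [:c:]) e = 0" by (simp add: c_def)
  then obtain t where t: "q - [:c:] = [:- e, 1:] * t" unfolding poly_eq_0_iff_dvd by (elim dvdE)
  have prod: "(\<Prod>e\<in>insert e E. [:- e, 1:]) = [:- e, 1:] * q"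
    using insert.hyps by (simp add: q_def)
  define v1 where "v1 = poly_mat q A *\<^sub>v v"
  define v2 where "v2 = poly_mat (t * [:- e, 1:]) A *\<^sub>v v"
  have U12: "v1 \<in> U" "v2 \<in> U" using inv insert.prems by (auto simp: v1_def v2_def)
  then have c12: "v1 \<in> carrier_vec n" "v2 \<in> carrier_vec n" using U by auto
  have "poly_mat [:- e, 1:] A *\<^sub>v v1 = 0\<^sub>v n"
    using insert.prems(2) by (simp only: v1_def prod poly_mat_mult_vec[OF A v])
  then have W1: "v1 \<in> W"
    using eig U12 c12 by (simp add: poly_mat_linear_vec[OF A])
  have "poly_mat q A *\<^sub>v v2 = poly_mat (t * ([:- e, 1:] * q)) A *\<^sub>v v"
    unfolding v2_def by (simp only: ac_simps flip: poly_mat_mult_vec[OF A v])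
  also have "\<dots> = 0\<^sub>v n"
    using insert.prems(2) mat_mult_zero_vec[OF poly_mat_carrier[OF A]]
    unfolding prod poly_mat_mult_vec[OF A v, of t] by simp
  finally have W2: "v2 \<in> W" using insert.IH U12 by (simp add: q_def)
  have "q = [:c:] + t * [:- e, 1:]" using t by (simp add: algebra_simps)
  then have "v1 = poly_mat [:c:] A *\<^sub>v v + v2"
    by (simp only: v1_def v2_def poly_mat_add_vec[OF A v])
  then have "v1 = c \<cdot>\<^sub>v v + v2"
    using v by (simp add: poly_mat_const[OF A] smult_one_mat_mult_vec)
  then have "v = (1 / c) \<cdot>\<^sub>v v1 + (- 1 / c) \<cdot>\<^sub>v v2"
    using v c12 c by (intro eq_vecI) (auto simp: field_simps)
  then show ?case using W1 W2 add smult by metis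
qed

lemma commuting_mat_vec:
  assumes "A \<in> carrier_mat n n" "B \<in> carrier_mat n n" "A * B = B * A" "v \<in> carrier_vec n"
  shows "A *\<^sub>v (B *\<^sub>v v) = B *\<^sub>v (A *\<^sub>v v)"
  using assms by (metis assoc_mult_mat_vec)

text \<open>Since \<open>poly_mat p Y\<close> commutes with \<open>Z\<close>, it acts on every
  eigenspace of \<open>Z\<close>; this allows such an eigenspace to be split further under
  \<open>Y\<close>.\<close>

lemma eigenspace_poly_mat_invariant:
  assumes Z: "Z \<in> carrier_mat n n" and Y: "Y \<in> carrier_mat n n" and ZY: "Z * Y = Y * Z"
    and v: "v \<in> carrier_vec n" and ev: "Z *\<^sub>v v = a \<cdot>\<^sub>v v"
  shows "Z *\<^sub>v (poly_mat p Y *\<^sub>v v) = a \<cdot>\<^sub>v (poly_mat p Y *\<^sub>v v)"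
proof -
  have "Z *\<^sub>v (poly_mat p Y *\<^sub>v v) = poly_mat p Y *\<^sub>v (Z *\<^sub>v v)"
    using commuting_mat_vec[OF Z poly_mat_carrier[OF Y] _ v, of p] poly_mat_commuteI[OF Y Z, of p] ZY by simp
  then show ?thesis using ev v mult_mat_vec[OF poly_mat_carrier[OF Y] v] by simp
qed

text \<open>The space is the sum of the eigenspaces of \<open>Z\<close>, and each of these is the
  sum of its intersections with the eigenspaces of \<open>Y\<close>. The kernel of \<open>T\<close>
  is a subspace containing all these pieces. Taking \<open>Y = Z\<close> gives the version for one
  matrix.\<close>

lemma mat_eq_zero_if_zero_on_joint_eigenvectors:
  fixes Z Y T :: "'a :: field mat"
  assumes Z: "Z \<in> carrier_mat n n" and Y: "Y \<in> carrier_mat n n" and T: "T \<in> carrier_mat n n"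
    and ZY: "Z * Y = Y * Z"
    and E: "finite E" "poly_mat (\<Prod>e\<in>E. [:- e, 1:]) Z = 0\<^sub>m n n"
    and F: "finite F" "poly_mat (\<Prod>e\<in>F. [:- e, 1:]) Y = 0\<^sub>m n n"
    and ev: "\<And>w a b. w \<in> carrier_vec n \<Longrightarrow> w \<noteq> 0\<^sub>v n \<Longrightarrow> Z *\<^sub>v w = a \<cdot>\<^sub>v w \<Longrightarrow> Y *\<^sub>v w = b \<cdot>\<^sub>v w
        \<Longrightarrow> T *\<^sub>v w = 0\<^sub>v n"
  shows "T = 0\<^sub>m n n"
proof (rule mat_eq_zeroI[OF T])
  define W where "W = {v \<in> carrier_vec n. T *\<^sub>v v = 0\<^sub>v n}"
  have W: "0\<^sub>v n \<in> W" "v \<in> W \<Longrightarrow> w \<in> W \<Longrightarrow> v + w \<in> W" "v \<in> W \<Longrightarrow> c \<cdot>\<^sub>v v \<in> W" for v w c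
    using T by (auto simp: W_def mult_add_distrib_mat_vec[OF T] mult_mat_vec[OF T])
  have eigZ: "v \<in> W" if v: "v \<in> carrier_vec n" "Z *\<^sub>v v = a \<cdot>\<^sub>v v" for v a
  proof (rule vec_in_sum_of_eigenspaces[OF Y _ _ W _ F(1), where U = "{v \<in> carrier_vec n. Z *\<^sub>v v = a \<cdot>\<^sub>v v}"])
    show "w \<in> W" if "w \<in> {v \<in> carrier_vec n. Z *\<^sub>v v = a \<cdot>\<^sub>v v}" "Y *\<^sub>v w = e \<cdot>\<^sub>v w" for w e
      using that ev[of w a e] T by (cases "w = 0\<^sub>v n") (auto simp: W_def)
    show "poly_mat p Y *\<^sub>v w \<in> {v \<in> carrier_vec n. Z *\<^sub>v v = a \<cdot>\<^sub>v v}"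
      if "w \<in> {v \<in> carrier_vec n. Z *\<^sub>v v = a \<cdot>\<^sub>v v}" for w p
      using that mult_mat_vec_carrier[OF poly_mat_carrier[OF Y]] eigenspace_poly_mat_invariant[OF Z Y ZY] by auto
    show "poly_mat (\<Prod>e\<in>F. [:- e, 1:]) Y *\<^sub>v v = 0\<^sub>v n" using F v by (simp add: zero_mat_mult_vec)
  qed (use v in auto)
  fix v :: "'a vec" assume v: "v \<in> carrier_vec n"
  have "v \<in> W"
  proof (rule vec_in_sum_of_eigenspaces[OF Z _ _ W _ E(1), where U = "carrier_vec n"])
    show "poly_mat p Z *\<^sub>v w \<in> carrier_vec n" if "w \<in> carrier_vec n" for w p
      using mult_mat_vec_carrier[OF poly_mat_carrier[OF Z] that] .
    show "poly_mat (\<Prod>e\<in>E. [:- e, 1:]) Z *\<^sub>v v = 0\<^sub>v n" using E v by (simp add: zero_mat_mult_vec)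
  qed (use v eigZ in auto)
  then show "T *\<^sub>v v = 0\<^sub>v n" by (simp add: W_def)
qed

text \<open>For a diagonal matrix, the product over its distinct diagonal entries kills every unit
  vector; similarity carries the annihilator over to \<open>A\<close>.\<close>

lemma diagonalizable_matE:
  fixes A :: "'a :: field mat"
  assumes A: "A \<in> carrier_mat n n" and "diagonalizable_mat A"
  obtains E where "finite E" "poly_mat (\<Prod>e\<in>E. [:- e, 1:]) A = 0\<^sub>m n n"
proof -
  obtain D P Q where w: "similar_mat_wit A D P Q" and D: "diagonal_mat D"
    using assms by (auto simp: diagonalizable_mat_def similar_mat_def)
  note w' = similar_mat_witD2[OF A w]
  define E where "E = (\<lambda>i. D $$ (i,i)) ` {..<n}"
  define p where "p = (\<Prod>e\<in>E. [:- e, 1:])"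
  have E: "finite E" by (simp add: E_def)
  have "poly_mat p D = 0\<^sub>m n n"
  proof (rule eq_matI)
    fix i j assume "i < dim_row (0\<^sub>m n n :: 'a mat)" "j < dim_col (0\<^sub>m n n :: 'a mat)"
    then have ij: "i < n" "j < n" by auto
    have "D *\<^sub>v unit_vec n j = D $$ (j,j) \<cdot>\<^sub>v unit_vec n j"
      using w'(5) D ij
      by (intro eq_vecI) (auto simp: diagonal_mat_def scalar_prod_right_unit)
    then have "poly_mat p D *\<^sub>v unit_vec n j = poly p (D $$ (j,j)) \<cdot>\<^sub>v unit_vec n j"
      by (intro poly_mat_eigenvector[OF w'(5)]) auto
    moreover have "poly p (D $$ (j,j)) = 0"
      using ij E by (auto simp: p_def poly_prod E_def)
    ultimately have "(poly_mat p D *\<^sub>v unit_vec n j) $ i = 0" using ij by simp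
    moreover have "(poly_mat p D *\<^sub>v unit_vec n j) $ i = poly_mat p D $$ (i,j)"
      using ij w'(5) by (simp add: scalar_prod_right_unit)
    ultimately show "poly_mat p D $$ (i,j) = 0\<^sub>m n n $$ (i,j)" using ij by simp
  qed (use w'(5) in auto)
  moreover have "poly_mat p A = P * poly_mat p D * Q"
    using poly_mat_similar[OF w, of p] by (auto simp: similar_mat_wit_def Let_def)
  ultimately have "poly_mat p A = 0\<^sub>m n n" using w'(6,7) by simp
  then show ?thesis using that E p_def by blast
qed

text \<open>A maximal independent set of eigenvectors spans every eigenvector, hence the whole space
  because the annihilator splits into distinct linear factors. Its members are therefore a basis,
  and form the columns of an invertible \<open>P\<close> with \<open>A * P = P * D\<close>.\<close>

lemma diagonalizable_matI:
  fixes A :: "'a :: field mat"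
  assumes A: "A \<in> carrier_mat n n" and E: "finite E" "poly_mat (\<Prod>e\<in>E. [:- e, 1:]) A = 0\<^sub>m n n"
  shows "diagonalizable_mat A"
proof -
  have ann: "poly_mat (\<Prod>e\<in>E. [:- e, 1:]) A *\<^sub>v v = 0\<^sub>v n" if "v \<in> carrier_vec n" for v
    using E that by (simp add: zero_mat_mult_vec)
  interpret vec_space "TYPE('a)" n .
  define U where "U = {v \<in> carrier_vec n. \<exists>e. A *\<^sub>v v = e \<cdot>\<^sub>v v}"
  \<comment> \<open>A maximal set exists because independent sets have at most \<open>n\<close>
    elements.\<close>
  have "\<exists>B. finite B \<and> maximal B (\<lambda>S. S \<subseteq> U \<and> lin_indpt S)"
  proof (rule maximal_exists[where B = "{}" and N = n])
    fix S assume "S \<subseteq> U \<and> lin_indpt S"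
    then show "finite S \<and> card S \<le> n"
      using li_le_dim[of S] by (auto simp: U_def dim_is_n)
  next
    show "{} \<subseteq> U \<and> lin_indpt {}" by (simp add: lin_dep_def)
  qed
  then obtain B where B: "finite B" "B \<subseteq> U" "lin_indpt B"
    and max: "\<And>S. B \<subseteq> S \<Longrightarrow> S \<subseteq> U \<Longrightarrow> lin_indpt S \<Longrightarrow> S = B"
    by (auto simp: maximal_def)
  have BC: "B \<subseteq> carrier_vec n" using B by (auto simp: U_def)
  have span: "v \<in> span B" if "v \<in> U" for v
  proof (cases "v \<in> B")
    case True
    then show ?thesis using BC by (simp add: span_mem)
  next
    case False
    have "lin_dep (B \<union> {v})"
      using max[of "B \<union> {v}"] that B False by blast
    then show ?thesis
      using lin_dep_iff_in_span[OF _ B(3) _ False] BC that by (auto simp: U_def)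
  qed
  have "carrier_vec n \<subseteq> span B"
  proof
    fix v :: "'a vec" assume v: "v \<in> carrier_vec n"
    show "v \<in> span B"
    proof (rule vec_in_sum_of_eigenspaces[OF A _ _ _ _ _ _ E(1), where U = "carrier_vec n"])
      show "poly_mat p A *\<^sub>v w \<in> carrier_vec n" if "w \<in> carrier_vec n" for w p
        using mult_mat_vec_carrier[OF poly_mat_carrier[OF A] that] .
      show "poly_mat (\<Prod>e\<in>E. [:- e, 1:]) A *\<^sub>v v = 0\<^sub>v n" using ann v by simp
      show "0\<^sub>v n \<in> span B" using vectorspace.span_zero[OF vectorspace_axioms, of B] by simp
      show "u + w \<in> span B" if "u \<in> span B" "w \<in> span B" for u w
        using span_add1[OF BC that] by simp
      show "c \<cdot>\<^sub>v w \<in> span B" if "w \<in> span B" for c w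
        using smult_in_span[OF BC that] .
      show "w \<in> span B" if "w \<in> carrier_vec n" "A *\<^sub>v w = e \<cdot>\<^sub>v w" for e w
        using that by (intro span) (auto simp: U_def)
    qed (use v in auto)
  qed
  then have "basis B" using B BC span_is_subset2[OF BC] by (auto simp: basis_def)
  then have card: "card B = n" using dim_basis[OF B(1)] dim_is_n by simp
  obtain bs where bs: "set bs = B" "distinct bs" using finite_distinct_list[OF B(1)] by auto
  then have len: "length bs = n" using card distinct_card by metis
  define P where "P = mat_of_cols n bs"
  have P: "P \<in> carrier_mat n n" using mat_of_cols_carrier(1)[of n bs] by (simp add: P_def len)
  have cols: "cols P = bs" using bs BC by (simp add: P_def)
  have "rank P = n" using lin_indpt_full_rank[OF P] cols bs B by simp
  then have "det P \<noteq> 0" using det_rank_iff[OF P] by simp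
  then obtain Q where Q: "Q \<in> carrier_mat n n" "Q * P = 1\<^sub>m n" "P * Q = 1\<^sub>m n"
    using det_non_zero_imp_unit[OF P, of ty] unfolding Units_def by (auto simp: ring_mat_def)
  have "\<forall>i<n. \<exists>e. A *\<^sub>v (bs ! i) = e \<cdot>\<^sub>v (bs ! i)"
  proof (intro allI impI)
    fix i assume "i < n"
    then have "bs ! i \<in> U" using B(2) bs(1) len nth_mem[of i bs] by blast
    then show "\<exists>e. A *\<^sub>v (bs ! i) = e \<cdot>\<^sub>v (bs ! i)" by (simp add: U_def)
  qed
  then obtain e where e: "\<And>i. i < n \<Longrightarrow> A *\<^sub>v (bs ! i) = e i \<cdot>\<^sub>v (bs ! i)" by metis
  define D where "D = mat n n (\<lambda>(i,j). if i = j then e i else 0)"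
  have D: "D \<in> carrier_mat n n" by (simp add: D_def)
  have AP: "A * P = P * D"
  proof (rule mat_col_eqI)
    fix j assume "j < dim_col (P * D)"
    then have j: "j < n" using D by simp
    have colP: "col P j = bs ! j" using cols_nth[of j P] P j cols by simp
    have "col D j = e j \<cdot>\<^sub>v unit_vec n j"
      using j by (intro eq_vecI) (auto simp: D_def)
    then have "col (P * D) j = P *\<^sub>v (e j \<cdot>\<^sub>v unit_vec n j)"
      using col_mult2[OF P D j] by metis
    also have "\<dots> = e j \<cdot>\<^sub>v (P *\<^sub>v unit_vec n j)"
      by (rule mult_mat_vec[OF P]) simp
    also have "P *\<^sub>v unit_vec n j = col P j"
      using P j by (intro eq_vecI) (auto simp: scalar_prod_right_unit)
    finally show "col (A * P) j = col (P * D) j"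
      using e[OF j] colP col_mult2[OF A P j] by simp
  qed (use A P D in auto)
  have "A = A * (P * Q)" using A Q by simp
  also have "\<dots> = A * P * Q" using A P Q by simp
  finally have "A = P * D * Q" by (simp add: AP)
  then have "similar_mat A D"
    using A P Q D by (intro similar_matI[of A D P Q n]) auto
  moreover have "diagonal_mat D" by (auto simp: D_def diagonal_mat_def)
  ultimately show ?thesis by (auto simp: diagonalizable_mat_def)
qed

section \<open>Minimal polynomials over the ground field\<close>

lemma poly_ideal_principal:
  fixes J :: "'a :: field poly set"
  assumes "J \<noteq> {}" and add: "\<And>p q. p \<in> J \<Longrightarrow> q \<in> J \<Longrightarrow> p + q \<in> J"
    and mult: "\<And>p q. p \<in> J \<Longrightarrow> q * p \<in> J"
  obtains d where "d \<in> J" "\<And>p. p \<in> J \<Longrightarrow> d dvd p"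
proof (cases "J \<subseteq> {0}")
  case True
  then show ?thesis using that assms(1) by auto
next
  case False
  \<comment> \<open>A nonzero element of least degree generates the ideal: the remainder of any
    element modulo \<open>d\<close> is again in the ideal and has smaller degree, so it is
    zero.\<close>
  define d where "d = arg_min degree (\<lambda>p. p \<in> J \<and> p \<noteq> 0)"
  obtain p0 where "p0 \<in> J \<and> p0 \<noteq> 0" using False by auto
  then have d: "d \<in> J" "d \<noteq> 0" and le: "\<And>p. p \<in> J \<Longrightarrow> p \<noteq> 0 \<Longrightarrow> degree d \<le> degree p"
    using arg_min_nat_lemma[of "\<lambda>p. p \<in> J \<and> p \<noteq> 0" p0 degree] by (auto simp: d_def)
  have "d dvd p" if "p \<in> J" for p
  proof -
    have "p mod d = p + (- (p div d)) * d" using div_mult_mod_eq[of p d] by (simp add: algebra_simps)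
    then have "p mod d \<in> J" using add[OF that mult[OF d(1)]] by metis
    then have "p mod d = 0" using le[of "p mod d"] degree_mod_less[OF d(2), of p] by (metis leD)
    then show ?thesis by (simp add: mod_eq_0_iff_dvd)
  qed
  then show ?thesis using that d by blast
qed

text \<open>The combination generates the ideal spanned by \<open>f\<close> and \<open>g\<close>, so
  it is a greatest common divisor, not normalized to be monic.\<close>

lemma poly_bezout:
  fixes f g :: "'a :: field poly"
  obtains u v where "u * f + v * g dvd f" "u * f + v * g dvd g"
proof -
  define J where "J = {u * f + v * g | u v. True}"
  have "f \<in> J" unfolding J_def mem_Collect_eq by (intro exI[of _ 1] exI[of _ 0]) simp
  have "g \<in> J" unfolding J_def mem_Collect_eq by (intro exI[of _ 0] exI[of _ 1]) simp
  obtain d where d: "d \<in> J" "\<And>p. p \<in> J \<Longrightarrow> d dvd p"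
  proof (rule poly_ideal_principal[of J])
    show "J \<noteq> {}" using \<open>f \<in> J\<close> by auto
    fix p q assume p: "p \<in> J"
    then obtain u v where p': "p = u * f + v * g" by (auto simp: J_def)
    show "q * p \<in> J" unfolding J_def mem_Collect_eq p'
      by (intro exI[of _ "q * u"] exI[of _ "q * v"]) (simp add: algebra_simps)
    assume "q \<in> J"
    then obtain u' v' where q': "q = u' * f + v' * g" by (auto simp: J_def)
    show "p + q \<in> J" unfolding J_def mem_Collect_eq p' q'
      by (intro exI[of _ "u + u'"] exI[of _ "v + v'"]) (simp add: algebra_simps)
  qed (use that in blast)
  then have "d dvd f" "d dvd g" using \<open>f \<in> J\<close> \<open>g \<in> J\<close> by auto
  moreover obtain u v where "d = u * f + v * g" using d(1) by (auto simp: J_def)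
  ultimately show ?thesis using that by blast
qed

text \<open>Write \<open>f = d * k\<close> with \<open>d\<close> a greatest common divisor of
  \<open>f\<close> and the product \<open>g\<close>. A root of \<open>k\<close> is a root of
  \<open>f\<close>, hence of \<open>g\<close> and of \<open>d\<close>, so it would be a multiple
  root of \<open>f\<close>. Thus \<open>k\<close> is constant and \<open>f\<close> divides
  \<open>d\<close>.\<close>

lemma dvd_prod_distinct_roots:
  fixes f :: "'a :: alg_closed_field poly"
  assumes "f \<noteq> 0" and simple: "\<And>x. poly f x = 0 \<Longrightarrow> poly (pderiv f) x \<noteq> 0"
  shows "f dvd (\<Prod>x\<in>{x. poly f x = 0}. [:- x, 1:])"
proof -
  define g where "g = (\<Prod>x\<in>{x. poly f x = 0}. [:- x, 1:])"
  have g: "poly g x = 0" if "poly f x = 0" for x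
    using that poly_roots_finite[OF assms(1)] by (auto simp: g_def poly_prod)
  obtain u v where d: "u * f + v * g dvd f" "u * f + v * g dvd g" using poly_bezout .
  then obtain k where k: "f = (u * f + v * g) * k" by blast
  have "degree k = 0"
  proof (rule ccontr)
    assume "degree k \<noteq> 0"
    then obtain x where x: "poly k x = 0" using alg_closed_imp_poly_has_root[of k] by auto
    have fx: "poly f x = 0" using arg_cong[OF k, of "\<lambda>p. poly p x"] x by simp
    have "poly (pderiv f) x = 0"
      using arg_cong[OF k, of "\<lambda>p. poly (pderiv p) x"] x fx g[OF fx] by (simp add: pderiv_mult pderiv_add)
    then show False using simple fx by blast
  qed
  then obtain c where c: "k = [:c:]" using degree_eq_zeroE by blast
  then have "c \<noteq> 0" using k assms(1) by auto
  have "f dvd d'" if "f = d' * k" for d'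
  proof -
    have "d' = smult (1 / c) f" using that c \<open>c \<noteq> 0\<close> by simp
    then show ?thesis by (simp add: dvd_smult)
  qed
  then have "f dvd u * f + v * g" using k by blast
  then show ?thesis using d g_def by (meson dvd_trans)
qed

section \<open>Evaluation in the algebraic closure\<close>

interpretation to_ac: field_hom "to_ac :: 'a :: field \<Rightarrow> 'a alg_closure"
  by unfold_locales auto

interpretation to_ac_poly: map_poly_inj_idom_hom "to_ac :: 'a :: field \<Rightarrow> 'a alg_closure" ..

abbreviation poly_ac :: "'a :: field poly \<Rightarrow> 'a alg_closure \<Rightarrow> 'a alg_closure" where
  "poly_ac p x \<equiv> poly (map_poly to_ac p) x"

lemma poly_ac_dvd: "p dvd q \<Longrightarrow> poly_ac p x = 0 \<Longrightarrow> poly_ac q x = 0"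
  by (auto simp: to_ac_poly.hom_mult)

lemma poly_ac_const: "poly_ac [:c:] x = to_ac c"
  by (simp add: to_ac.map_poly_pCons_hom)

lemma poly_ac_has_root: "degree p > 0 \<Longrightarrow> \<exists>x. poly_ac p x = 0"
  by (rule alg_closed_imp_poly_has_root) simp

text \<open>A greatest common divisor of positive degree would have a root in the closure, common to
  \<open>f\<close> and \<open>g\<close>. So it is a constant, nonzero because it divides
  \<open>f\<close>, and can be scaled to 1.\<close>

lemma bezout_if_no_common_root:
  fixes f g :: "'a :: field poly"
  assumes "f \<noteq> 0" and "\<And>x. poly_ac f x = 0 \<Longrightarrow> poly_ac g x \<noteq> 0"
  obtains u v where "u * f + v * g = 1"
proof -
  obtain u v where d: "u * f + v * g dvd f" "u * f + v * g dvd g" using poly_bezout .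
  have "degree (u * f + v * g) = 0"
    using poly_ac_has_root[of "u * f + v * g"] poly_ac_dvd[OF d(1)] poly_ac_dvd[OF d(2)] assms(2) by blast
  then obtain c where c: "u * f + v * g = [:c:]" using degree_eq_zeroE by blast
  then have "c \<noteq> 0" using d(1) assms(1) by auto
  then have "smult (1 / c) u * f + smult (1 / c) v * g = 1"
    using c by (simp add: one_pCons flip: smult_add_right)
  then show ?thesis using that by blast
qed

text \<open>Split off a greatest common divisor \<open>d'\<close> of \<open>f\<close> and
  \<open>g\<close>. It is not constant, since any root of \<open>f\<close> is shared with
  \<open>g\<close>. The cofactor has smaller degree and divides some power of \<open>g\<close> by
  induction; \<open>d'\<close> costs one further factor \<open>g\<close>.\<close>

lemma dvd_power_if_roots_subset:
  fixes f g :: "'a :: field poly"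
  assumes "f \<noteq> 0" and "\<And>x. poly_ac f x = 0 \<Longrightarrow> poly_ac g x = 0"
  shows "\<exists>k. f dvd g ^ k"
  using assms
proof (induction "degree f" arbitrary: f rule: less_induct)
  case less
  show ?case
  proof (cases "degree f = 0")
    case True
    then obtain c where "f = [:c:]" using degree_eq_zeroE by blast
    then have "f dvd g ^ 0" using less.prems by (simp add: is_unit_iff_degree)
    then show ?thesis by blast
  next
    case False
    obtain u v where d: "u * f + v * g dvd f" "u * f + v * g dvd g" using poly_bezout .
    define d' where "d' = u * f + v * g"
    obtain x where x: "poly_ac f x = 0" using poly_ac_has_root False by blast
    then have d'x: "poly_ac d' x = 0"
      using less.prems(2)[OF x] by (simp add: d'_def to_ac_poly.hom_mult to_ac_poly.hom_add)
    obtain k where k: "f = d' * k" using d by (auto simp: d'_def)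
    then have nz: "d' \<noteq> 0" "k \<noteq> 0" using less.prems by auto
    have "degree d' \<noteq> 0"
    proof
      assume "degree d' = 0"
      then obtain c where "d' = [:c:]" using degree_eq_zeroE by blast
      then show False using nz d'x by (auto simp: map_poly_pCons)
    qed
    then have "degree k < degree f" using k nz by (simp add: degree_mult_eq)
    moreover have "poly_ac g x = 0" if "poly_ac k x = 0" for x
      using less.prems(2) that k by (simp add: to_ac_poly.hom_mult)
    ultimately obtain m where "k dvd g ^ m" using less.hyps nz by blast
    then have "d' * k dvd g * g ^ m" using d(2) by (intro mult_dvd_mono) (simp add: d'_def)
    then have "f dvd g ^ Suc m" using k by simp
    then show ?thesis by blast
  qed
qed

section \<open>Existence and uniqueness of the minimal polynomial\<close>

lemma min_poly_K_unique:
  assumes "monic p" "poly_ac p x = 0" "\<And>q. poly_ac q x = 0 \<Longrightarrow> p dvd q"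
  shows "min_poly_K x = p"
  unfolding min_poly_K_def
proof (rule the_equality)
  fix r :: "'a poly" assume r: "monic r \<and> poly_ac r x = 0 \<and> (\<forall>q. poly_ac q x = 0 \<longrightarrow> r dvd q)"
  then show "r = p" using assms by (intro poly_dvd_antisym) auto
qed (use assms in auto)

text \<open>The polynomials vanishing at \<open>x\<close> form an ideal, nonzero because
  \<open>x\<close> is algebraic. Its generator, scaled to be monic, is the polynomial described by
  the definition.\<close>

lemma
  shows monic_min_poly_K: "monic (min_poly_K x)"
    and min_poly_K_root: "poly_ac (min_poly_K x) x = 0"
    and min_poly_K_dvd: "poly_ac q x = 0 \<Longrightarrow> min_poly_K x dvd q"
proof -
  define J where "J = {p :: 'a poly. poly_ac p x = 0}"
  obtain p0 :: "'a poly" where p0: "p0 \<noteq> 0" "p0 \<in> J" using alg_closure_algebraic[of x] by (auto simp: J_def)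
  obtain d where d: "d \<in> J" "\<And>p. p \<in> J \<Longrightarrow> d dvd p"
    by (rule poly_ideal_principal[of J])
      (use p0 in \<open>auto simp: J_def to_ac_poly.hom_mult to_ac_poly.hom_add\<close>)
  have nz: "d \<noteq> 0" using d(2)[OF p0(2)] p0(1) by auto
  define p where "p = smult (inverse (lead_coeff d)) d"
  have p: "monic p" "poly_ac p x = 0" "\<And>q. poly_ac q x = 0 \<Longrightarrow> p dvd q"
    using nz d by (auto simp: p_def J_def smult_dvd to_ac.map_poly_hom_smult)
  have "min_poly_K x = p" using min_poly_K_unique[OF p] .
  then show "monic (min_poly_K x)" "poly_ac (min_poly_K x) x = 0"
    "poly_ac q x = 0 \<Longrightarrow> min_poly_K x dvd q" using p by auto
qed

lemma min_poly_K_nonzero [simp]: "min_poly_K x \<noteq> 0"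
  using monic_min_poly_K[of x] by auto

lemma deg_K_pos: "deg_K x > 0"
proof (rule ccontr)
  assume "\<not> deg_K x > 0"
  then have "min_poly_K x = 1"
    using monic_degree_0[OF monic_min_poly_K[of x]] by (simp add: deg_K_def)
  then show False using min_poly_K_root[of x] by simp
qed

text \<open>Irreducibility in another form. In \<open>min_poly_K x = min_poly_K y * s\<close> the
  cofactor \<open>s\<close> has degree too small to vanish at \<open>x\<close>, so \<open>x\<close>
  is a root of \<open>min_poly_K y\<close> and the two monic polynomials divide each other.\<close>

lemma min_poly_K_eq_if_root:
  assumes "poly_ac (min_poly_K x) y = 0"
  shows "min_poly_K y = min_poly_K x"
proof -
  obtain s where s: "min_poly_K x = min_poly_K y * s" using min_poly_K_dvd[OF assms] by blast
  then have "s \<noteq> 0" by auto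
  then have deg: "deg_K x = deg_K y + degree s"
    by (simp add: deg_K_def s degree_mult_eq)
  have "poly_ac (min_poly_K y) x = 0"
  proof (rule ccontr)
    assume "poly_ac (min_poly_K y) x \<noteq> 0"
    then have "poly_ac s x = 0" using min_poly_K_root[of x] by (simp add: s to_ac_poly.hom_mult)
    then have "deg_K x \<le> degree s"
      using dvd_imp_degree_le[OF min_poly_K_dvd] \<open>s \<noteq> 0\<close> by (simp add: deg_K_def)
    then show False using deg deg_K_pos[of y] by simp
  qed
  then have "min_poly_K x dvd min_poly_K y" by (rule min_poly_K_dvd)
  then show ?thesis
    using min_poly_K_dvd[OF assms] monic_min_poly_K[of x] monic_min_poly_K[of y]
    by (intro poly_dvd_antisym) auto
qed

section \<open>Regularity and translation by scalars\<close>

lemma K_regular_elem_cong: "min_poly_K x = min_poly_K y \<Longrightarrow> K_regular_elem x = K_regular_elem y"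
  by (simp add: K_regular_elem_def deg_K_def)

lemma of_nat_deg_K_nonzero:
  "K_regular_elem (x :: 'a :: field alg_closure) \<Longrightarrow> of_nat (deg_K x) \<noteq> (0 :: 'a)"
  by (simp add: K_regular_elem_def of_nat_eq_0_iff_char_dvd)

text \<open>Substituting \<open>X - a\<close> is invertible, with inverse the substitution of
  \<open>X + a\<close>, and turns polynomials vanishing at \<open>x\<close> into polynomials
  vanishing at \<open>x + to_ac a\<close>.\<close>

lemma min_poly_K_shift: "min_poly_K (x + to_ac a) = pcompose (min_poly_K x) [:- a, 1:]"
proof (rule min_poly_K_unique)
  show "monic (pcompose (min_poly_K x) [:- a, 1:])"
    using monic_min_poly_K[of x] lead_coeff_comp[of "[:- a, 1:]" "min_poly_K x"] by simp
  have pc: "poly_ac (pcompose q [:c, 1:]) z = poly_ac q (to_ac c + z)" for q :: "'a poly" and c z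
    by (simp add: to_ac.map_poly_pcompose poly_pcompose)
  show "poly_ac (pcompose (min_poly_K x) [:- a, 1:]) (x + to_ac a) = 0"
    using min_poly_K_root[of x] by (simp add: pc)
  fix q assume "poly_ac q (x + to_ac a) = 0"
  then have "poly_ac (pcompose q [:a, 1:]) x = 0" by (simp add: pc add.commute)
  then obtain r where "pcompose q [:a, 1:] = min_poly_K x * r" using min_poly_K_dvd by blast
  then have "pcompose (pcompose q [:a, 1:]) [:- a, 1:] = pcompose (min_poly_K x) [:- a, 1:] * pcompose r [:- a, 1:]"
    by (simp add: pcompose_mult)
  moreover have "pcompose (pcompose q [:a, 1:]) [:- a, 1:] = q"
    by (simp add: pcompose_pCons flip: pcompose_assoc)
  ultimately show "pcompose (min_poly_K x) [:- a, 1:] dvd q" by simp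
qed

text \<open>The two top terms of \<open>(X + c)^(m+1)\<close> are \<open>X^(m+1)\<close> and
  \<open>(m+1) c X^m\<close>. The degree is only bounded above, which is the form that the induction
  reproduces.\<close>

lemma coeff_pcompose_shift:
  fixes p :: "'a :: comm_ring_1 poly"
  assumes "degree p \<le> Suc m"
  shows "coeff (pcompose p [:c, 1:]) (Suc m) = coeff p (Suc m) \<and>
    coeff (pcompose p [:c, 1:]) m = coeff p m + of_nat (Suc m) * c * coeff p (Suc m)"
  using assms
proof (induction p arbitrary: m)
  case 0
  then show ?case by simp
next
  case (pCons a p)
  show ?case
  proof (cases m)
    case 0
    then have "degree p = 0" using pCons by (cases "p = 0") auto
    then obtain b where "p = [:b:]" using degree_eq_zeroE by blast
    then show ?thesis using 0 by (simp add: pcompose_pCons)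
  next
    case (Suc k)
    have "degree p \<le> Suc k" using pCons.prems Suc by (cases "p = 0") auto
    note IH = pCons.IH[OF this]
    \<comment> \<open>Multiplication by \<open>X + c\<close> would bring in the coefficient of index
      \<open>Suc (Suc k)\<close>; it lies above the degree and vanishes.\<close>
    have "degree (pcompose p [:c, 1:]) \<le> Suc k"
      using degree_pcompose_le[of p "[:c, 1:]"] \<open>degree p \<le> Suc k\<close> by simp
    then have "coeff (pcompose p [:c, 1:]) (Suc (Suc k)) = 0" by (intro coeff_eq_0) simp
    then show ?thesis using IH Suc by (simp add: pcompose_pCons coeff_pCons algebra_simps)
  qed
qed

lemma deg_K_shift: "deg_K (x + to_ac a) = deg_K x"
  by (simp add: deg_K_def min_poly_K_shift degree_pcompose)

lemma K_regular_elem_shift: "K_regular_elem (x + to_ac a) = K_regular_elem x"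
  by (simp add: K_regular_elem_def deg_K_shift)

text \<open>\<open>H_K x\<close> is the mean of the roots of the minimal polynomial, so translating
  the roots translates it. In coefficients, the second one changes by \<open>- d * a\<close>, and
  regularity makes the degree \<open>d\<close> invertible.\<close>

lemma H_K_shift:
  assumes "K_regular_elem x"
  shows "H_K (x + to_ac a) = H_K x + a"
proof -
  obtain m where m: "deg_K x = Suc m" using deg_K_pos[of x] gr0_conv_Suc by blast
  then have "coeff (min_poly_K x) (Suc m) = 1" using monic_min_poly_K[of x] by (simp add: deg_K_def)
  then have "coeff (pcompose (min_poly_K x) [:- a, 1:]) m = coeff (min_poly_K x) m - of_nat (Suc m) * a"
    using coeff_pcompose_shift[of "min_poly_K x" m "- a"] m by (simp add: deg_K_def)
  then show ?thesis using of_nat_deg_K_nonzero[OF assms] unfolding H_K_def deg_K_shift min_poly_K_shift m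
    by (simp add: field_simps del: of_nat_Suc)
qed

section \<open>Separability\<close>

lemma min_poly_K_separable:
  assumes "K_regular_elem x"
  shows "poly_ac (pderiv (min_poly_K x)) x \<noteq> 0"
proof
  assume "poly_ac (pderiv (min_poly_K x)) x = 0"
  \<comment> \<open>The derivative has smaller degree, yet is nonzero: its coefficient of index
    \<open>deg_K x - 1\<close> is \<open>deg_K x\<close>, which regularity keeps nonzero in the
    field.\<close>
  then have dvd: "min_poly_K x dvd pderiv (min_poly_K x)" by (rule min_poly_K_dvd)
  obtain m where m: "deg_K x = Suc m" using deg_K_pos[of x] gr0_conv_Suc by blast
  then have "coeff (pderiv (min_poly_K x)) m = of_nat (deg_K x)"
    using monic_min_poly_K[of x] by (simp add: coeff_pderiv deg_K_def)
  then have "pderiv (min_poly_K x) \<noteq> 0" using of_nat_deg_K_nonzero[OF assms] by auto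
  then have "degree (min_poly_K x) \<le> degree (pderiv (min_poly_K x))"
    using dvd by (simp add: dvd_imp_degree_le)
  moreover have "degree (pderiv (min_poly_K x)) \<le> degree (min_poly_K x) - 1" by (rule degree_pderiv_le)
  ultimately show False using m by (simp add: deg_K_def)
qed

lemma poly_prod_min_poly_K_eq_0:
  assumes "finite R" and "poly_ac (\<Prod>p\<in>min_poly_K ` R. p) x = 0"
  shows "min_poly_K x \<in> min_poly_K ` R"
proof -
  obtain y where "y \<in> R" "poly_ac (min_poly_K y) x = 0"
    using assms by (auto simp: to_ac_poly.hom_prod poly_prod)
  then show ?thesis using min_poly_K_eq_if_root by force
qed

text \<open>The product runs over a set of polynomials, so conjugate elements contribute a single
  factor. Only the factor \<open>min_poly_K x\<close> vanishes at \<open>x\<close>; the product rule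
  leaves its derivative at \<open>x\<close> times the nonzero value of the other factors.\<close>

lemma separable_prod_min_poly_K:
  fixes R :: "'a :: field alg_closure set"
  assumes fin: "finite R" and reg: "\<And>x. x \<in> R \<Longrightarrow> K_regular_elem x"
    and x: "poly_ac (\<Prod>p\<in>min_poly_K ` R. p) x = 0"
  shows "poly_ac (pderiv (\<Prod>p\<in>min_poly_K ` R. p)) x \<noteq> 0"
proof -
  define P where "P = min_poly_K ` R - {min_poly_K x}"
  have "min_poly_K ` R = insert (min_poly_K x) P" "min_poly_K x \<notin> P" "finite P"
    using poly_prod_min_poly_K_eq_0[OF fin x] fin by (auto simp: P_def)
  then have prod: "(\<Prod>p\<in>min_poly_K ` R. p) = min_poly_K x * (\<Prod>p\<in>P. p)" by simp
  have "poly_ac (\<Prod>p\<in>P. p) x \<noteq> 0"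
  proof
    assume "poly_ac (\<Prod>p\<in>P. p) x = 0"
    then obtain p where "p \<in> P" "poly_ac p x = 0"
      using \<open>finite P\<close> by (auto simp: to_ac_poly.hom_prod poly_prod)
    then show False using min_poly_K_eq_if_root by (fastforce simp: P_def)
  qed
  moreover have "K_regular_elem x"
    using poly_prod_min_poly_K_eq_0[OF fin x] reg K_regular_elem_cong by blast
  ultimately show ?thesis
    using min_poly_K_separable[of x] min_poly_K_root[of x] unfolding prod
    by (simp add: pderiv_mult to_ac_poly.hom_mult to_ac_poly.hom_add)
qed

section \<open>Newton iteration and interpolation\<close>

lemma pcompose_taylor:
  fixes p a b :: "'a :: idom poly"
  shows "\<exists>r. pcompose p (a + b) = pcompose p a + pcompose (pderiv p) a * b + b\<^sup>2 * r"
proof (induction p)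
  case 0
  then show ?case by (intro exI[of _ 0]) simp
next
  case (pCons c p)
  then obtain r where r: "pcompose p (a + b) = pcompose p a + pcompose (pderiv p) a * b + b\<^sup>2 * r" by blast
  show ?case
    \<comment> \<open>The witness collects the terms divisible by \<open>b\<close> squared in
      \<open>(a + b)\<close> times the expansion for \<open>p\<close>. No factorial is inverted, so
      any characteristic is allowed.\<close>
    by (intro exI[of _ "pcompose (pderiv p) a + (a + b) * r"])
      (simp add: pcompose_pCons pderiv_pCons pcompose_add r algebra_simps power2_eq_square)
qed

text \<open>Newton iteration for a root of \<open>\<mu>\<close> modulo powers of \<open>\<mu>\<close>, starting at \<open>X\<close>.\<close>
lemma newton_root_mod_power:
  fixes \<mu> :: "'a :: field poly"
  assumes bez: "u * pderiv \<mu> + v * \<mu> = 1"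
  shows "\<exists>s. \<mu> dvd s - [:0, 1:] \<and> \<mu> ^ Suc k dvd pcompose \<mu> s"
proof (induction k)
  case 0
  show ?case by (intro exI[of _ "[:0, 1:]"]) simp
next
  case (Suc k)
  then obtain s where s: "\<mu> dvd s - [:0, 1:]" "\<mu> ^ Suc k dvd pcompose \<mu> s" by blast
  define m where "m = pcompose \<mu> s"
  \<comment> \<open>The Newton correction: \<open>u\<close> inverts \<open>pderiv \<mu>\<close>
    modulo \<open>\<mu>\<close>, so \<open>pcompose u s\<close> inverts the derivative at
    \<open>s\<close> modulo \<open>m\<close>. The linear terms then cancel up to a multiple of
    \<open>m\<close> squared.\<close>
  define b where "b = - (pcompose u s * m)"
  obtain r where r: "pcompose \<mu> (s + b) = m + pcompose (pderiv \<mu>) s * b + b\<^sup>2 * r"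
    using pcompose_taylor[of \<mu> s b] by (auto simp: m_def)
  have "pcompose (u * pderiv \<mu> + v * \<mu>) s = 1" by (simp add: bez pcompose_1)
  then have "pcompose u s * pcompose (pderiv \<mu>) s = 1 - pcompose v s * m"
    by (simp add: pcompose_add pcompose_mult m_def algebra_simps)
  then have "m + pcompose (pderiv \<mu>) s * b = m - (1 - pcompose v s * m) * m"
    by (simp add: b_def mult.assoc mult.left_commute mult.commute)
  then have "pcompose \<mu> (s + b) = m\<^sup>2 * (pcompose v s + (pcompose u s)\<^sup>2 * r)"
    unfolding r by (simp add: b_def power2_eq_square algebra_simps)
  then have "m\<^sup>2 dvd pcompose \<mu> (s + b)" by simp
  \<comment> \<open>Squaring doubles the exponent \<open>k + 1\<close>, and \<open>2 (k + 1)\<close>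
    is at least \<open>k + 2\<close>.\<close>
  moreover have "\<mu> ^ Suc (Suc k) dvd m\<^sup>2"
  proof -
    have "\<mu> ^ (Suc k * 2) dvd m\<^sup>2"
      unfolding power_mult using s(2) by (intro dvd_power_same) (simp add: m_def)
    moreover have "\<mu> ^ Suc (Suc k) dvd \<mu> ^ (Suc k * 2)" by (rule le_imp_power_dvd) simp
    ultimately show ?thesis by (rule dvd_trans[rotated])
  qed
  moreover have "\<mu> dvd s + b - [:0, 1:]"
  proof -
    have "\<mu> dvd m" using s(2) by (auto simp: m_def intro: dvd_trans[of _ "\<mu> ^ Suc k"])
    then have "\<mu> dvd b" by (simp add: b_def)
    then have "\<mu> dvd (s - [:0, 1:]) + b" using s(1) by (rule dvd_add[rotated])
    then show ?thesis by (simp add: algebra_simps)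
  qed
  ultimately show ?case by (blast intro: dvd_trans)
qed

lemma poly_chinese_remainder:
  fixes P :: "'a :: field poly set" and c :: "'a poly \<Rightarrow> 'a poly"
  assumes "finite P" and "0 \<notin> P"
    and "\<And>p q x. p \<in> P \<Longrightarrow> q \<in> P \<Longrightarrow> poly_ac p x = 0 \<Longrightarrow> poly_ac q x = 0 \<Longrightarrow> p = q"
  shows "\<exists>h. \<forall>p\<in>P. p dvd h - c p"
  using assms
proof (induction P rule: finite_induct)
  case empty
  then show ?case by simp
next
  case (insert p P)
  have "\<exists>h. \<forall>q\<in>P. q dvd h - c q"
  proof (rule insert.IH)
    show "0 \<notin> P" using insert.prems(1) by simp
    show "q = r" if "q \<in> P" "r \<in> P" "poly_ac q x = 0" "poly_ac r x = 0" for q r x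
      by (rule insert.prems(2)[OF _ _ that(3,4)]) (use that in auto)
  qed
  then obtain h where h: "\<And>q. q \<in> P \<Longrightarrow> q dvd h - c q" by blast
  define m where "m = (\<Prod>q\<in>P. q)"
  have "poly_ac m x \<noteq> 0" if "poly_ac p x = 0" for x
  proof
    assume "poly_ac m x = 0"
    moreover have "poly_ac m x = (\<Prod>q\<in>P. poly_ac q x)"
      by (simp add: m_def to_ac_poly.hom_prod poly_prod)
    ultimately obtain q where q: "q \<in> P" "poly_ac q x = 0"
      using insert.hyps(1) by auto
    have "p = q" by (rule insert.prems(2)[OF _ _ that q(2)]) (use q in auto)
    then show False using \<open>q \<in> P\<close> insert.hyps(2) by simp
  qed
  then obtain u v where uv: "u * p + v * m = 1"
    using bezout_if_no_common_root[of p m] insert.prems(1) by (metis insertI1)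
  \<comment> \<open>The correction is divisible by \<open>m\<close>, so the old congruences survive,
    while \<open>v * m\<close> is 1 modulo \<open>p\<close>, so \<open>g\<close> is congruent to
    \<open>c p\<close> there.\<close>
  define g where "g = h + m * (v * (c p - h))"
  have "p dvd g - c p"
  proof -
    have "g - c p = (c p - h) * (v * m - 1)" by (simp add: g_def algebra_simps)
    also have "v * m - 1 = - (u * p)" using uv by (simp add: algebra_simps)
    finally show ?thesis by simp
  qed
  moreover have "q dvd g - c q" if "q \<in> P" for q
  proof -
    have "q dvd m" using dvd_prodI[OF insert.hyps(1) that, of "\<lambda>q. q"] by (simp add: m_def)
    then have "q dvd (h - c q) + m * (v * (c p - h))" using h[OF that] by simp
    then show ?thesis by (simp add: g_def algebra_simps)
  qed
  ultimately show ?case by (intro exI[of _ g]) blast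
qed

lemma H_K_interpolation:
  fixes R :: "'a :: field alg_closure set"
  assumes "finite R"
  obtains h where "\<And>x. poly_ac (\<Prod>p\<in>min_poly_K ` R. p) x = 0 \<Longrightarrow> poly_ac h x = to_ac (H_K x)"
proof -
  \<comment> \<open>\<open>H_K\<close> depends on the minimal polynomial alone. Each residue is
    therefore a constant from the ground field, which is why the interpolating \<open>h\<close> has
    coefficients there.\<close>
  define c :: "'a poly \<Rightarrow> 'a poly" where "c p = [:- coeff p (degree p - 1) / of_nat (degree p):]" for p
  have "\<exists>h. \<forall>p\<in>min_poly_K ` R. p dvd h - c p"
  proof (rule poly_chinese_remainder)
    show "p = q" if "p \<in> min_poly_K ` R" "q \<in> min_poly_K ` R" "poly_ac p x = 0" "poly_ac q x = 0" for p q x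
      using that min_poly_K_eq_if_root by (metis imageE)
  qed (use assms in auto)
  then obtain h where h: "\<And>p. p \<in> min_poly_K ` R \<Longrightarrow> p dvd h - c p" by blast
  have "poly_ac h x = to_ac (H_K x)" if "poly_ac (\<Prod>p\<in>min_poly_K ` R. p) x = 0" for x
  proof -
    have "min_poly_K x dvd h - c (min_poly_K x)"
      using poly_prod_min_poly_K_eq_0[OF assms that] h by blast
    then have "poly_ac (h - c (min_poly_K x)) x = 0"
      using poly_ac_dvd min_poly_K_root by blast
    then show ?thesis by (simp add: c_def to_ac_poly.hom_minus H_K_def deg_K_def poly_ac_const add_eq_0_iff2)
  qed
  then show ?thesis using that by blast
qed

section \<open>Decompositions\<close>

lemma smult_vec_eq_0D:
  fixes c :: "'a :: field"
  assumes "w \<in> carrier_vec n" "w \<noteq> 0\<^sub>v n" "c \<cdot>\<^sub>v w = 0\<^sub>v n"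
  shows "c = 0"
proof (rule ccontr)
  assume "c \<noteq> 0"
  have "w = (1 / c) \<cdot>\<^sub>v (c \<cdot>\<^sub>v w)"
    using \<open>c \<noteq> 0\<close> by (intro eq_vecI) auto
  then show False using assms by auto
qed

lemma eigenvalue_root_of_annihilator:
  fixes A :: "'a :: field mat"
  assumes "A \<in> carrier_mat n n" "poly_mat p A = 0\<^sub>m n n"
    and "w \<in> carrier_vec n" "w \<noteq> 0\<^sub>v n" "A *\<^sub>v w = a \<cdot>\<^sub>v w"
  shows "poly p a = 0"
proof (rule smult_vec_eq_0D[OF assms(3,4)])
  show "poly p a \<cdot>\<^sub>v w = 0\<^sub>v n"
    using poly_mat_eigenvector[OF assms(1,3,5), of p] assms by (simp add: zero_mat_mult_vec)
qed

lemma eigenvalue_in_split_annihilator: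
  fixes A :: "'a :: field mat"
  assumes "A \<in> carrier_mat n n" "finite E" "poly_mat (\<Prod>e\<in>E. [:- e, 1:]) A = 0\<^sub>m n n"
    and "w \<in> carrier_vec n" "w \<noteq> 0\<^sub>v n" "A *\<^sub>v w = a \<cdot>\<^sub>v w"
  shows "a \<in> E"
  using eigenvalue_root_of_annihilator[OF assms(1,3-)] assms(2) by (auto simp: poly_prod)

text \<open>The eigenspace of \<open>Z\<close> containing \<open>v\<close> is invariant under
  \<open>Y\<close>. If it held no eigenvector of \<open>Y\<close>, splitting \<open>v\<close> under
  \<open>Y\<close> would place it in the zero subspace.\<close>

lemma joint_eigenvector_exists:
  fixes Z Y :: "'a :: field mat"
  assumes Z: "Z \<in> carrier_mat n n" and Y: "Y \<in> carrier_mat n n" and ZY: "Z * Y = Y * Z"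
    and F: "finite F" "poly_mat (\<Prod>e\<in>F. [:- e, 1:]) Y = 0\<^sub>m n n"
    and v: "v \<in> carrier_vec n" "v \<noteq> 0\<^sub>v n" "Z *\<^sub>v v = a \<cdot>\<^sub>v v"
  obtains w b where "w \<in> carrier_vec n" "w \<noteq> 0\<^sub>v n" "Z *\<^sub>v w = a \<cdot>\<^sub>v w" "Y *\<^sub>v w = b \<cdot>\<^sub>v w"
proof (rule ccontr)
  assume no: "\<not> thesis"
  note witness = that
  have "v \<in> {0\<^sub>v n}"
  proof (rule vec_in_sum_of_eigenspaces[OF Y _ _ _ _ _ _ F(1), where U = "{v \<in> carrier_vec n. Z *\<^sub>v v = a \<cdot>\<^sub>v v}"])
    show "w \<in> {0\<^sub>v n}" if "w \<in> {v \<in> carrier_vec n. Z *\<^sub>v v = a \<cdot>\<^sub>v v}" "Y *\<^sub>v w = e \<cdot>\<^sub>v w" for w e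
      using that no witness[of w e] by blast
    show "poly_mat p Y *\<^sub>v w \<in> {v \<in> carrier_vec n. Z *\<^sub>v v = a \<cdot>\<^sub>v v}"
      if "w \<in> {v \<in> carrier_vec n. Z *\<^sub>v v = a \<cdot>\<^sub>v v}" for w p
      using that mult_mat_vec_carrier[OF poly_mat_carrier[OF Y]] eigenspace_poly_mat_invariant[OF Z Y ZY] by auto
    show "poly_mat (\<Prod>e\<in>F. [:- e, 1:]) Y *\<^sub>v v = 0\<^sub>v n" using F v by (simp add: zero_mat_mult_vec)
  qed (use v in auto)
  then show False using v by simp
qed

lemma nilpotent_matD:
  assumes "N \<in> carrier_mat n n" "nilpotent_mat N"
  obtains k where "poly_mat ([:0, 1:] ^ k) N = 0\<^sub>m n n"
  using assms that by (auto simp: nilpotent_mat_def poly_mat_pow poly_mat_X)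

text \<open>Take the last nonzero vector among the iterates of \<open>v\<close> under
  \<open>N\<close>. Writing it as a polynomial in \<open>N\<close> applied to \<open>v\<close> keeps
  it inside every eigenspace containing \<open>v\<close> of a matrix commuting with
  \<open>N\<close>.\<close>

lemma nilpotent_mat_kernel_vec:
  assumes N: "N \<in> carrier_mat n n" "nilpotent_mat N" and v: "v \<in> carrier_vec n" "v \<noteq> 0\<^sub>v n"
  obtains p where "poly_mat p N *\<^sub>v v \<noteq> 0\<^sub>v n" "N *\<^sub>v (poly_mat p N *\<^sub>v v) = 0\<^sub>v n"
proof -
  obtain k where "poly_mat ([:0, 1:] ^ k) N = 0\<^sub>m n n" using nilpotent_matD[OF N] .
  then have "\<exists>j. poly_mat ([:0, 1:] ^ j) N *\<^sub>v v = 0\<^sub>v n"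
    using v by (intro exI[of _ k]) (simp add: zero_mat_mult_vec)
  then obtain j where "poly_mat ([:0, 1:] ^ j) N *\<^sub>v v = 0\<^sub>v n"
    "\<And>i. i < j \<Longrightarrow> poly_mat ([:0, 1:] ^ i) N *\<^sub>v v \<noteq> 0\<^sub>v n"
    using exists_least_iff[of "\<lambda>j. poly_mat ([:0, 1:] ^ j) N *\<^sub>v v = 0\<^sub>v n"] by blast
  moreover from this have "j \<noteq> 0" using N v by (auto simp: poly_mat_1[OF N(1)])
  then obtain i where "j = Suc i" using not0_implies_Suc by blast
  ultimately have "poly_mat ([:0, 1:] ^ i) N *\<^sub>v v \<noteq> 0\<^sub>v n"
    "poly_mat ([:0, 1:] * [:0, 1:] ^ i) N *\<^sub>v v = 0\<^sub>v n" by (auto simp only: power_Suc lessI)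
  then show ?thesis using that by (metis poly_mat_mult_vec[OF N(1) v(1)] poly_mat_X[OF N(1)])
qed

lemma nilpotent_mat_eigenvalue:
  fixes N :: "'a :: field mat"
  assumes "N \<in> carrier_mat n n" "nilpotent_mat N"
    and "w \<in> carrier_vec n" "w \<noteq> 0\<^sub>v n" "N *\<^sub>v w = a \<cdot>\<^sub>v w"
  shows "a = 0"
proof -
  obtain k where "poly_mat ([:0, 1:] ^ k) N = 0\<^sub>m n n" using nilpotent_matD[OF assms(1,2)] .
  from eigenvalue_root_of_annihilator[OF assms(1) this assms(3-)] show ?thesis
    by (simp add: poly_power)
qed

text \<open>An eigenvector of \<open>A\<close> for \<open>a\<close> is an eigenvector of
  \<open>poly_mat f A\<close> for \<open>poly f a\<close>. Diagonalizability thus passes to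
  polynomials in the matrix.\<close>

lemma split_annihilator_poly_mat:
  fixes A :: "'a :: field mat"
  assumes A: "A \<in> carrier_mat n n" and E: "finite E" "poly_mat (\<Prod>e\<in>E. [:- e, 1:]) A = 0\<^sub>m n n"
  shows "poly_mat (\<Prod>e\<in>poly f ` E. [:- e, 1:]) (poly_mat f A) = 0\<^sub>m n n"
proof (rule mat_eq_zero_if_zero_on_joint_eigenvectors[OF A A _ refl E E])
  define g where "g = (\<Prod>e\<in>poly f ` E. [:- e, 1:])"
  fix w a b assume w: "w \<in> carrier_vec n" "w \<noteq> 0\<^sub>v n" "A *\<^sub>v w = a \<cdot>\<^sub>v w"
  have "a \<in> E" by (rule eigenvalue_in_split_annihilator[OF A E w])
  then have "poly g (poly f a) = 0" using E(1) by (auto simp: g_def poly_prod)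
  then show "poly_mat g (poly_mat f A) *\<^sub>v w = 0\<^sub>v n"
    using poly_mat_eigenvector[OF poly_mat_carrier[OF A] w(1) poly_mat_eigenvector[OF A w(1,3)], of g f] w(1)
    by auto
qed (use A in auto)

section \<open>Base change of matrices to the algebraic closure\<close>

lemma map_mat_poly_mat:
  assumes A: "A \<in> carrier_mat n n"
  shows "map_mat to_ac (poly_mat p A) = poly_mat (map_poly to_ac p) (map_mat to_ac A)"
proof (induction p)
  case 0
  have "map_mat to_ac (0\<^sub>m n n) = 0\<^sub>m n n" by (intro eq_matI) auto
  then show ?case using A by simp
next
  case (pCons c p)
  have A': "map_mat to_ac A \<in> carrier_mat n n" using A by simp
  have "map_mat to_ac (poly_mat (pCons c p) A) = map_mat to_ac (c \<cdot>\<^sub>m 1\<^sub>m n) + map_mat to_ac (A * poly_mat p A)"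
    unfolding poly_mat_pCons[OF A] using A by (intro eq_matI) auto
  also have "map_mat to_ac (c \<cdot>\<^sub>m 1\<^sub>m n) = to_ac c \<cdot>\<^sub>m 1\<^sub>m n" by (intro eq_matI) auto
  also have "map_mat to_ac (A * poly_mat p A) = map_mat to_ac A * map_mat to_ac (poly_mat p A)"
    by (rule to_ac.mat_hom_mult[OF A poly_mat_carrier[OF A]])
  finally show ?case using pCons by (simp add: poly_mat_pCons[OF A'] to_ac.map_poly_pCons_hom)
qed

lemma map_mat_to_ac_eq_0_iff: "map_mat to_ac A = 0\<^sub>m n n \<longleftrightarrow> A = 0\<^sub>m n n"
proof -
  have "map_mat to_ac (0\<^sub>m n n) = 0\<^sub>m n n" by (intro eq_matI) auto
  then show ?thesis using to_ac.mat_hom_inj by metis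
qed

lemma nilpotent_map_mat:
  assumes "N \<in> carrier_mat n n" "nilpotent_mat N"
  shows "nilpotent_mat (map_mat to_ac N)"
  using assms map_mat_to_ac_eq_0_iff[of _ n]
  by (auto simp: nilpotent_mat_def simp flip: to_ac.mat_hom_pow)

lemma map_mat_commute:
  assumes "A \<in> carrier_mat n n" "B \<in> carrier_mat n n" "A * B = B * A"
  shows "map_mat to_ac A * map_mat to_ac B = map_mat to_ac B * map_mat to_ac A"
  using assms by (metis to_ac.mat_hom_mult)

lemma map_mat_to_ac_add:
  "A \<in> carrier_mat n m \<Longrightarrow> B \<in> carrier_mat n m \<Longrightarrow>
    map_mat to_ac (A + B) = map_mat to_ac A + map_mat to_ac B"
  by (intro eq_matI) auto

lemma map_mat_to_ac_minus:
  "A \<in> carrier_mat n m \<Longrightarrow> B \<in> carrier_mat n m \<Longrightarrow>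
    map_mat to_ac (A - B) = map_mat to_ac A - map_mat to_ac B"
  by (intro eq_matI) auto

lemma mat_minus_eq_0D:
  fixes A B :: "'a :: ab_group_add mat"
  assumes "A \<in> carrier_mat n m" "B \<in> carrier_mat n m" "A - B = 0\<^sub>m n m"
  shows "A = B"
proof (rule eq_matI)
  fix i j assume "i < dim_row B" "j < dim_col B"
  then show "A $$ (i,j) = B $$ (i,j)"
    using arg_cong[OF assms(3), of "\<lambda>C. C $$ (i,j)"] assms(1,2) by auto
qed (use assms in auto)

section \<open>Comparison of decompositions\<close>

lemma add_vec_eigen:
  fixes A B :: "'a :: field mat"
  assumes "A \<in> carrier_mat n n" "B \<in> carrier_mat n n" "w \<in> carrier_vec n"
    and "A *\<^sub>v w = a \<cdot>\<^sub>v w" "B *\<^sub>v w = b \<cdot>\<^sub>v w"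
  shows "(A + B) *\<^sub>v w = (a + b) \<cdot>\<^sub>v w"
  using assms by (simp add: add_mult_distrib_mat_vec[of _ n n] add_smult_distrib_vec)

lemma minus_vec_eigen:
  fixes A B :: "'a :: field mat"
  assumes "A \<in> carrier_mat n n" "B \<in> carrier_mat n n" "w \<in> carrier_vec n"
    and "A *\<^sub>v w = a \<cdot>\<^sub>v w" "B *\<^sub>v w = b \<cdot>\<^sub>v w"
  shows "(A - B) *\<^sub>v w = (a - b) \<cdot>\<^sub>v w"
  using assms by (simp add: minus_mult_distrib_mat_vec[of _ n n]) (intro eq_vecI, auto simp: algebra_simps)

text \<open>As a polynomial in \<open>M\<close>, the matrix \<open>S\<close> commutes with
  \<open>S'\<close>, and so does \<open>N\<close>. If \<open>S\<close> and \<open>S'\<close> act on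
  a joint eigenvector by \<open>a\<close> and \<open>b\<close>, then the nilpotent
  \<open>N' = S + N - S'\<close> has eigenvalue \<open>a - b\<close>, which forces
  \<open>a = b\<close>.\<close>

lemma additive_JCD_unique:
  fixes M :: "'a :: field mat"
  assumes jcd: "additive_JCD n M S N" and s: "S = poly_mat s M" and jcd': "additive_JCD n M S' N'"
  shows "S' = S" "N' = N"
proof -
  note [simp] = map_mat_to_ac_add[of _ n n] map_mat_to_ac_minus[of _ n n]
  have c: "S \<in> carrier_mat n n" "N \<in> carrier_mat n n" "S' \<in> carrier_mat n n" "N' \<in> carrier_mat n n"
    and M: "M = S + N" "M = S' + N'" and nil: "nilpotent_mat N" "nilpotent_mat N'"
    and comm: "S * N = N * S" "S' * N' = N' * S'"
    and ss: "semisimple_mat S" "semisimple_mat S'"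
    using jcd jcd' by (auto simp: additive_JCD_def)
  have cM: "M \<in> carrier_mat n n" using M c by simp
  have "M * S' = S' * M"
    unfolding M(2) using c comm by (simp add: add_mult_distrib_mat[of _ n n _ _ n] mult_add_distrib_mat[of _ n n _ n])
  then have SS': "S * S' = S' * S" using poly_mat_commuteI[OF cM c(3)] s by simp
  have N: "N = M - S" using c by (intro eq_matI) (auto simp: M(1))
  have NS': "N * S' = S' * N"
    unfolding N using c cM SS' \<open>M * S' = S' * M\<close>
    by (simp add: minus_mult_distrib_mat[of _ n n _ _ n] mult_minus_distrib_mat[of _ n n _ n])
  let ?S = "map_mat to_ac S" and ?N = "map_mat to_ac N" and ?S' = "map_mat to_ac S'" and ?N' = "map_mat to_ac N'"
  have cL: "?S \<in> carrier_mat n n" "?N \<in> carrier_mat n n" "?S' \<in> carrier_mat n n" "?N' \<in> carrier_mat n n"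
    using c by auto
  obtain E where E: "finite E" "poly_mat (\<Prod>e\<in>E. [:- e, 1:]) ?S = 0\<^sub>m n n"
    using diagonalizable_matE[OF cL(1)] ss by (auto simp: semisimple_mat_def)
  obtain F where F: "finite F" "poly_mat (\<Prod>e\<in>F. [:- e, 1:]) ?S' = 0\<^sub>m n n"
    using diagonalizable_matE[OF cL(3)] ss by (auto simp: semisimple_mat_def)
  have "?S - ?S' = 0\<^sub>m n n"
  proof (rule mat_eq_zero_if_zero_on_joint_eigenvectors[OF cL(1,3) _ _ E F])
    show "?S * ?S' = ?S' * ?S" using map_mat_commute[OF c(1,3) SS'] .
    fix w a b assume w: "w \<in> carrier_vec n" "w \<noteq> 0\<^sub>v n" "?S *\<^sub>v w = a \<cdot>\<^sub>v w" "?S' *\<^sub>v w = b \<cdot>\<^sub>v w"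
    \<comment> \<open>Moving from \<open>w\<close> into the kernel of \<open>N\<close> keeps both
      eigenvalues, because \<open>N\<close> commutes with \<open>S\<close> and with
      \<open>S'\<close>; on the new vector \<open>M\<close> acts as \<open>a\<close>.\<close>
    obtain p where p: "poly_mat p ?N *\<^sub>v w \<noteq> 0\<^sub>v n" "?N *\<^sub>v (poly_mat p ?N *\<^sub>v w) = 0\<^sub>v n"
      using nilpotent_mat_kernel_vec[OF cL(2) nilpotent_map_mat[OF c(2) nil(1)] w(1,2)] .
    define w' where "w' = poly_mat p ?N *\<^sub>v w"
    have cw': "w' \<in> carrier_vec n" using mult_mat_vec_carrier[OF poly_mat_carrier[OF cL(2)] w(1)] by (simp add: w'_def)
    have w': "?S *\<^sub>v w' = a \<cdot>\<^sub>v w'" "?S' *\<^sub>v w' = b \<cdot>\<^sub>v w'"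
      unfolding w'_def
      using eigenspace_poly_mat_invariant[OF cL(1,2) map_mat_commute[OF c(1,2) comm(1)] w(1,3)]
        eigenspace_poly_mat_invariant[OF cL(3,2) map_mat_commute[OF c(3,2)] w(1,4)] NS' by auto
    have "?N *\<^sub>v w' = 0 \<cdot>\<^sub>v w'" using p cw' by (auto simp: w'_def[symmetric])
    then have "(?S + ?N) *\<^sub>v w' = a \<cdot>\<^sub>v w'" using add_vec_eigen[OF cL(1,2) cw' w'(1)] by simp
    moreover have "?N' = (?S + ?N) - ?S'"
    proof -
      have "N' = (S + N) - S'" unfolding M(1)[symmetric] using c by (intro eq_matI) (auto simp: M(2))
      then show ?thesis using c by simp
    qed
    ultimately have "?N' *\<^sub>v w' = (a - b) \<cdot>\<^sub>v w'"
      using minus_vec_eigen[OF _ cL(3) cw' _ w'(2), of "?S + ?N" a] cL by simp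
    then have "a - b = 0"
      by (rule nilpotent_mat_eigenvalue[OF cL(4) nilpotent_map_mat[OF c(4) nil(2)] cw' p(1)[folded w'_def]])
    then show "(?S - ?S') *\<^sub>v w = 0\<^sub>v n" using minus_vec_eigen[OF cL(1,3) w(1,3,4)] w(1) by auto
  qed (use cL in auto)
  then have "map_mat to_ac S = map_mat to_ac S'" using mat_minus_eq_0D[OF cL(1,3)] by simp
  then show "S' = S" using to_ac.mat_hom_inj by metis
  have "N' = M - S'" using c by (intro eq_matI) (auto simp: M(2))
  then show "N' = N" using N \<open>S' = S\<close> by simp
qed

lemma map_poly_prod_linear:
  "map_poly to_ac (\<Prod>e\<in>E. [:- e, 1:]) = (\<Prod>e\<in>to_ac ` E. [:- e, 1:])"
  by (simp add: to_ac_poly.hom_prod to_ac.map_poly_pCons_hom prod.reindex inj_on_def)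

text \<open>Diagonalizability over the ground field itself puts all roots of the annihilator in the
  image of \<open>to_ac\<close>. Uniqueness uses this to write an eigenvalue of \<open>H'\<close> as
  a scalar by which \<open>H_K\<close> can be shifted.\<close>

lemma split_annihilator_map_mat:
  fixes A :: "'a :: field mat"
  assumes A: "A \<in> carrier_mat n n" and "diagonalizable_mat A"
  obtains E where "finite E" "poly_mat (\<Prod>e\<in>to_ac ` E. [:- e, 1:]) (map_mat to_ac A) = 0\<^sub>m n n"
proof -
  obtain E where E: "finite E" "poly_mat (\<Prod>e\<in>E. [:- e, 1:]) A = 0\<^sub>m n n"
    using diagonalizable_matE[OF assms] .
  have "poly_mat (map_poly to_ac (\<Prod>e\<in>E. [:- e, 1:])) (map_mat to_ac A) = 0\<^sub>m n n"
    using map_mat_poly_mat[OF A] E(2) map_mat_to_ac_eq_0_iff by metis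
  then show ?thesis using that E(1) by (simp add: map_poly_prod_linear)
qed

lemma complete_JCD_imp_additive_JCD:
  fixes M :: "'a :: field mat"
  assumes "complete_JCD n M H V N"
  shows "additive_JCD n M (H + V) N"
proof -
  have c: "H \<in> carrier_mat n n" "V \<in> carrier_mat n n" "N \<in> carrier_mat n n"
    and M: "M = H + V + N" and comm: "H * V = V * H" "H * N = N * H" "V * N = N * V"
    and "diagonalizable_mat H" "semisimple_mat V" "nilpotent_mat N"
    using assms by (auto simp: complete_JCD_def)
  let ?H = "map_mat to_ac H" and ?V = "map_mat to_ac V"
  have cL: "?H \<in> carrier_mat n n" "?V \<in> carrier_mat n n" using c by auto
  obtain E where E: "finite E" "poly_mat (\<Prod>e\<in>E. [:- e, 1:]) ?H = 0\<^sub>m n n"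
    using split_annihilator_map_mat[OF c(1) \<open>diagonalizable_mat H\<close>] by (metis finite_imageI)
  obtain F where F: "finite F" "poly_mat (\<Prod>e\<in>F. [:- e, 1:]) ?V = 0\<^sub>m n n"
    using diagonalizable_matE[OF cL(2)] \<open>semisimple_mat V\<close> by (auto simp: semisimple_mat_def)
  \<comment> \<open>On a joint eigenvector the sum \<open>H + V\<close> acts by a sum of two
    eigenvalues, so the product over all such sums annihilates it.\<close>
  define G where "G = (\<lambda>(a,b). a + b) ` (E \<times> F)"
  have G: "finite G" using E F by (simp add: G_def)
  have "poly_mat (\<Prod>e\<in>G. [:- e, 1:]) (?H + ?V) = 0\<^sub>m n n"
  proof (rule mat_eq_zero_if_zero_on_joint_eigenvectors[OF cL _ _ E F])
    show "?H * ?V = ?V * ?H" using map_mat_commute[OF c(1,2) comm(1)] .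
    fix w a b assume w: "w \<in> carrier_vec n" "w \<noteq> 0\<^sub>v n" "?H *\<^sub>v w = a \<cdot>\<^sub>v w" "?V *\<^sub>v w = b \<cdot>\<^sub>v w"
    have "a \<in> E" "b \<in> F"
      using eigenvalue_in_split_annihilator[OF cL(1) E w(1-3)] eigenvalue_in_split_annihilator[OF cL(2) F w(1,2,4)] by auto
    then have "a + b \<in> G" by (force simp: G_def)
    then have "poly (\<Prod>e\<in>G. [:- e, 1:]) (a + b) = 0" using G by (auto simp: poly_prod)
    then show "poly_mat (\<Prod>e\<in>G. [:- e, 1:]) (?H + ?V) *\<^sub>v w = 0\<^sub>v n"
      using poly_mat_eigenvector[OF _ w(1) add_vec_eigen[OF cL w(1,3,4)]] cL w(1) by auto
  qed (use cL in auto)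
  then have "semisimple_mat (H + V)"
    using diagonalizable_matI[OF _ G, of "?H + ?V" n] cL c
    by (auto simp: semisimple_mat_def map_mat_to_ac_add[of _ n n])
  moreover have "(H + V) * N = N * (H + V)"
    using c comm by (simp add: add_mult_distrib_mat[of _ n n _ _ n] mult_add_distrib_mat[of _ n n _ n])
  ultimately show ?thesis using c M \<open>nilpotent_mat N\<close> by (auto simp: additive_JCD_def)
qed


section \<open>The complete decomposition\<close>

theorem theorem2p6:
  fixes M :: "'a::field mat" and n :: nat
  assumes "M \<in> carrier_mat n n" and "K_regular_mat M"
  shows "\<exists>H V N. complete_JCD n M H V N \<and>
     (\<forall>H' V' N'. complete_JCD n M H' V' N' \<longrightarrow> H' = H \<and> V' = V \<and> N' = N) \<and>
     (\<exists>p. H = poly_mat p M) \<and> (\<exists>q. V = poly_mat q M) \<and> (\<exists>r. N = poly_mat r M) \<and>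
     additive_JCD n M (H + V) N \<and>
     (\<forall>S N'. additive_JCD n M S N' \<longrightarrow> S = H + V \<and> N' = N)"
proof -
  note M = assms(1)
  define \<chi> where "\<chi> = char_poly M"
  have cML: "map_mat to_ac M \<in> carrier_mat n n" using M by simp
  have chi_nz: "\<chi> \<noteq> 0" using degree_monic_char_poly[OF M] by (auto simp: \<chi>_def)
  define R where "R = {x. poly_ac \<chi> x = 0}"
  have R_eq: "x \<in> R \<longleftrightarrow> eigenvalue (map_mat to_ac M) x" for x
    using eigenvalue_root_char_poly[OF cML] to_ac.char_poly_hom[OF M] by (simp add: R_def \<chi>_def)
  have finR: "finite R" unfolding R_def by (rule poly_roots_finite) (simp add: chi_nz)
  have regR: "K_regular_elem x" if "x \<in> R" for x
    using assms(2) that R_eq by (auto simp: K_regular_mat_def)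
  define \<mu> where "\<mu> = (\<Prod>p\<in>min_poly_K ` R. p)"
  have mu_nz: "\<mu> \<noteq> 0" using finR by (auto simp: \<mu>_def)
  have mu_root: "poly_ac \<mu> x = 0" if "x \<in> R" for x
  proof (rule poly_ac_dvd[OF _ min_poly_K_root])
    show "min_poly_K x dvd \<mu>"
      using dvd_prodI[of "min_poly_K ` R" "min_poly_K x" "\<lambda>p. p"] finR that by (simp add: \<mu>_def)
  qed
  have mu_reg: "K_regular_elem x" if "poly_ac \<mu> x = 0" for x
    using poly_prod_min_poly_K_eq_0[OF finR] that regR K_regular_elem_cong unfolding \<mu>_def by blast
  have mu_sep: "poly_ac (pderiv \<mu>) x \<noteq> 0" if "poly_ac \<mu> x = 0" for x
    using separable_prod_min_poly_K[OF finR regR] that by (simp add: \<mu>_def)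
  \<comment> \<open>Here \<open>v\<close> inverts the derivative of \<open>\<mu>\<close> modulo
    \<open>\<mu>\<close>, as Newton iteration requires. The exponent \<open>k\<close> below fixes
    how far to iterate.\<close>
  obtain u v where bez: "u * \<mu> + v * pderiv \<mu> = 1"
    using bezout_if_no_common_root[OF mu_nz mu_sep] .
  obtain k where k: "\<chi> dvd \<mu> ^ k"
    using dvd_power_if_roots_subset[OF chi_nz] mu_root by (auto simp: R_def)
  obtain s where s: "\<mu> dvd s - [:0, 1:]" "\<mu> ^ Suc k dvd pcompose \<mu> s"
    using newton_root_mod_power[of v \<mu> u k] bez by (auto simp: add.commute)
  obtain h where h: "\<And>x. poly_ac \<mu> x = 0 \<Longrightarrow> poly_ac h x = to_ac (H_K x)"
    using H_K_interpolation[OF finR] unfolding \<mu>_def by blast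

  define S where "S = poly_mat s M"
  define N where "N = poly_mat ([:0, 1:] - s) M"
  define H where "H = poly_mat h S"
  define V where "V = poly_mat ([:0, 1:] - h) S"
  have c: "S \<in> carrier_mat n n" "N \<in> carrier_mat n n" using M by (auto simp: S_def N_def)
  then have cHV: "H \<in> carrier_mat n n" "V \<in> carrier_mat n n" by (auto simp: H_def V_def)
  have H: "H = poly_mat (pcompose h s) M" and V: "V = poly_mat (pcompose ([:0, 1:] - h) s) M"
    by (simp_all only: H_def V_def S_def poly_mat_pcompose[OF M])
  have S_eq: "S = H + V"
    using poly_mat_add[OF c(1), of h "[:0, 1:] - h"] poly_mat_X[OF c(1)] by (simp add: H_def V_def)
  have M_eq: "M = S + N"
    using poly_mat_add[OF M, of s "[:0, 1:] - s"] poly_mat_X[OF M] by (simp add: S_def N_def)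

  \<comment> \<open>By Cayley-Hamilton, divisibility by \<open>\<chi>\<close> turns into vanishing
    at \<open>M\<close>: first \<open>\<mu>\<close> vanishes at \<open>S\<close>, then the
    \<open>k\<close>-th power of \<open>N\<close> is zero.\<close>
  have "\<chi> dvd pcompose \<mu> s"
    using k s(2) by (meson dvd_trans le_imp_power_dvd lessI less_imp_le)
  then have mu_S: "poly_mat \<mu> S = 0\<^sub>m n n"
    using poly_mat_zero_dvd[OF M cayley_hamilton[OF M]] poly_mat_pcompose[OF M, of \<mu> s]
    by (simp add: S_def \<chi>_def)
  have "\<mu> dvd [:0, 1:] - s" using s(1) by (metis dvd_minus_iff minus_diff_eq)
  then have "\<chi> dvd ([:0, 1:] - s) ^ k" using k by (meson dvd_power_same dvd_trans)
  then have "N ^\<^sub>m k = 0\<^sub>m n n"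
    unfolding N_def \<chi>_def poly_mat_pow[OF M, symmetric] by (rule poly_mat_zero_dvd[OF M cayley_hamilton[OF M]])
  then have nil: "nilpotent_mat N" using c by (auto simp: nilpotent_mat_def)

  let ?S = "map_mat to_ac S" and ?H = "map_mat to_ac H" and ?V = "map_mat to_ac V"
  have cL: "?S \<in> carrier_mat n n" "?H \<in> carrier_mat n n" "?V \<in> carrier_mat n n" using c cHV by auto
  define E where "E = {x. poly_ac \<mu> x = 0}"
  have E: "finite E" unfolding E_def by (rule poly_roots_finite) (simp add: mu_nz)
  have mu_SL: "poly_mat (map_poly to_ac \<mu>) ?S = 0\<^sub>m n n"
    using map_mat_poly_mat[OF c(1), of \<mu>] mu_S map_mat_to_ac_eq_0_iff by metis
  \<comment> \<open>All roots of \<open>\<mu>\<close> are simple, so over the closure it divides the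
    product of the distinct linear factors at its roots.\<close>
  have ES: "poly_mat (\<Prod>e\<in>E. [:- e, 1:]) ?S = 0\<^sub>m n n"
  proof (rule poly_mat_zero_dvd[OF cL(1) mu_SL])
    show "map_poly to_ac \<mu> dvd (\<Prod>e\<in>E. [:- e, 1:])"
      unfolding E_def using mu_nz mu_sep
      by (intro dvd_prod_distinct_roots) (auto simp: to_ac.map_poly_pderiv)
  qed
  have HL: "?H = poly_mat (map_poly to_ac h) ?S"
    and VL: "?V = poly_mat (map_poly to_ac ([:0, 1:] - h)) ?S"
    by (simp_all only: H_def V_def map_mat_poly_mat[OF c(1)])
  have poly_id_minus: "poly_ac ([:0, 1:] - h) x = x - poly_ac h x" for x
    by (simp add: to_ac_poly.hom_minus to_ac.map_poly_pCons_hom)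

  \<comment> \<open>The eigenvalues of \<open>H\<close> are values of \<open>H_K\<close>, hence
    scalars. The split annihilator over the closure therefore comes from one over the ground field,
    which makes \<open>H\<close> diagonalizable there.\<close>
  have "poly_mat (map_poly to_ac (\<Prod>e\<in>H_K ` E. [:- e, 1:])) ?H = 0\<^sub>m n n"
  proof -
    have "poly_ac h ` E = to_ac ` H_K ` E" using h by (auto simp: E_def image_image)
    then show ?thesis
      using split_annihilator_poly_mat[OF cL(1) E ES, of "map_poly to_ac h"]
      by (simp only: HL map_poly_prod_linear)
  qed
  then have "poly_mat (\<Prod>e\<in>H_K ` E. [:- e, 1:]) H = 0\<^sub>m n n"
    using map_mat_poly_mat[OF cHV(1)] map_mat_to_ac_eq_0_iff by metis
  then have diagH: "diagonalizable_mat H"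
    using diagonalizable_matI[OF cHV(1), of "H_K ` E"] E by simp
  have ssV: "semisimple_mat V"
    unfolding semisimple_mat_def VL
    using diagonalizable_matI[OF poly_mat_carrier[OF cL(1)] _ split_annihilator_poly_mat[OF cL(1) E ES]] E
    by simp

  have vert: "x \<in> Ker_H_K" if ev: "eigenvalue ?V x" for x
  proof -
    obtain v where v: "v \<in> carrier_vec n" "v \<noteq> 0\<^sub>v n" "?V *\<^sub>v v = x \<cdot>\<^sub>v v"
      using ev cHV by (auto simp: eigenvalue_def eigenvector_def)
    \<comment> \<open>A joint eigenvector with \<open>S\<close> identifies \<open>x\<close> as
      \<open>y\<close> minus \<open>H_K y\<close> for a root \<open>y\<close> of
      \<open>\<mu>\<close>; the shift rule then gives regularity and value 0 under
      \<open>H_K\<close>.\<close>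
    have "?V * ?S = ?S * ?V"
      unfolding VL using poly_mat_commuteI[OF cL(1) cL(1) refl] by simp
    then obtain w y where w: "w \<in> carrier_vec n" "w \<noteq> 0\<^sub>v n" "?V *\<^sub>v w = x \<cdot>\<^sub>v w" "?S *\<^sub>v w = y \<cdot>\<^sub>v w"
      using joint_eigenvector_exists[OF cL(3,1) _ E ES v] by blast
    have y: "poly_ac \<mu> y = 0" using eigenvalue_root_of_annihilator[OF cL(1) mu_SL w(1,2,4)] .
    have "(x - (y - to_ac (H_K y))) \<cdot>\<^sub>v w = 0\<^sub>v n"
      using poly_mat_eigenvector[OF cL(1) w(1,4), of "map_poly to_ac ([:0, 1:] - h)"] w(1,3)
      unfolding VL[symmetric] poly_id_minus h[OF y]
      by (auto simp: vec_eq_iff algebra_simps)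
    then have "x = y + to_ac (- H_K y)" using smult_vec_eq_0D[OF w(1,2)] by force
    then show ?thesis
      using mu_reg[OF y] by (simp only: Ker_H_K_def mem_Collect_eq K_regular_elem_shift H_K_shift) simp
  qed
  then have vertV: "K_vertical_mat V"
    by (auto simp: K_vertical_mat_def K_regular_mat_def Ker_H_K_def)

  have jcd: "complete_JCD n M H V N"
    unfolding complete_JCD_def
  proof (intro conjI)
    show "M = H + V + N" using M_eq S_eq by simp
    show "H * V = V * H" "H * N = N * H" "V * N = N * V"
      unfolding H V N_def by (rule poly_mat_commute[OF M])+
  qed (use c cHV diagH vertV ssV nil in auto)
  have add: "additive_JCD n M (H + V) N" by (rule complete_JCD_imp_additive_JCD[OF jcd])
  have S_poly: "H + V = poly_mat s M" using S_eq S_def by simp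
  note uniq = additive_JCD_unique[OF add S_poly]

  have "H' = H \<and> V' = V \<and> N' = N" if jcd': "complete_JCD n M H' V' N'" for H' V' N'
  proof -
    have c': "H' \<in> carrier_mat n n" "V' \<in> carrier_mat n n" and comm': "H' * V' = V' * H'"
      and "diagonalizable_mat H'" "semisimple_mat V'" and vert': "K_vertical_mat V'"
      using jcd' by (auto simp: complete_JCD_def)
    \<comment> \<open>Uniqueness of the additive decomposition settles \<open>N'\<close> and the
      sum; it remains to recover \<open>H'\<close> from \<open>S\<close>.\<close>
    have S': "H' + V' = S" and N': "N' = N"
      using uniq[OF complete_JCD_imp_additive_JCD[OF jcd']] S_eq by auto
    let ?H' = "map_mat to_ac H'" and ?V' = "map_mat to_ac V'"
    have cL': "?H' \<in> carrier_mat n n" "?V' \<in> carrier_mat n n" using c' by auto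
    have SL': "?S = ?H' + ?V'" using map_mat_to_ac_add[OF c'] S' by simp
    obtain A where A: "finite A" "poly_mat (\<Prod>e\<in>to_ac ` A. [:- e, 1:]) ?H' = 0\<^sub>m n n"
      using split_annihilator_map_mat[OF c'(1) \<open>diagonalizable_mat H'\<close>] .
    have A': "finite (to_ac ` A)" using A by simp
    obtain B where B: "finite B" "poly_mat (\<Prod>e\<in>B. [:- e, 1:]) ?V' = 0\<^sub>m n n"
      using diagonalizable_matE[OF cL'(2)] \<open>semisimple_mat V'\<close> by (auto simp: semisimple_mat_def)
    have "?H - ?H' = 0\<^sub>m n n"
    proof (rule mat_eq_zero_if_zero_on_joint_eigenvectors[OF cL' _ _ A' A(2) B])
      show "?H' * ?V' = ?V' * ?H'" using map_mat_commute[OF c' comm'] .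
      fix w a b assume w: "w \<in> carrier_vec n" "w \<noteq> 0\<^sub>v n" "?H' *\<^sub>v w = a \<cdot>\<^sub>v w" "?V' *\<^sub>v w = b \<cdot>\<^sub>v w"
      obtain \<alpha> where \<alpha>: "a = to_ac \<alpha>"
        using eigenvalue_in_split_annihilator[OF cL'(1) A' A(2) w(1-3)] by blast
      have "eigenvalue ?V' b" using w c' by (auto simp: eigenvalue_def eigenvector_def)
      then have b: "K_regular_elem b" "H_K b = 0"
        using vert' by (auto simp: K_vertical_mat_def Ker_H_K_def)
      have Sw: "?S *\<^sub>v w = (a + b) \<cdot>\<^sub>v w" unfolding SL' by (rule add_vec_eigen[OF cL' w(1,3,4)])
      \<comment> \<open>Since \<open>a + b\<close> is an eigenvalue of \<open>S\<close>, the
        interpolation property of \<open>h\<close> applies there, and \<open>H_K\<close> of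
        \<open>b\<close> shifted by \<alpha> is \<open>0 + \<alpha>\<close>. So \<open>H\<close> and
        \<open>H'\<close> both act by \<open>a\<close>.\<close>
      have "poly_ac \<mu> (a + b) = 0" using eigenvalue_root_of_annihilator[OF cL(1) mu_SL w(1,2) Sw] .
      then have "poly_ac h (a + b) = a" using h H_K_shift[OF b(1), of \<alpha>] b(2) \<alpha> by (simp add: add.commute)
      then have "?H *\<^sub>v w = a \<cdot>\<^sub>v w"
        unfolding HL using poly_mat_eigenvector[OF cL(1) w(1) Sw] by simp
      then show "(?H - ?H') *\<^sub>v w = 0\<^sub>v n"
        using minus_vec_eigen[OF cL(2) cL'(1) w(1) _ w(3)] w(1) by auto
    qed (use cL cL' in auto)
    then have "?H' = ?H" using mat_minus_eq_0D[OF cL(2) cL'(1)] by simp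
    then have H': "H' = H" using to_ac.mat_hom_inj by metis
    have "V' = S - H'" using c' unfolding S'[symmetric] by (intro eq_matI) auto
    moreover have "V = S - H" using cHV unfolding S_eq by (intro eq_matI) auto
    ultimately show ?thesis using H' N' by simp
  qed
  then show ?thesis using jcd add uniq H V N_def by blast
qed

end
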